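(* Let $K$ and $M$ be integers with $1\le M\le K-1$, let $q\ge2$ be a prime power and let $l\ge1$. The Modified Partition-and-Code (MPC) protocol (with parameters $K,M,q,l$) is a scalar-linear PIR-CSI--I protocol, and its rate is $\left\lceil\frac{K}{M+1}\right\rceil^{-1}$.
   Context: Setup. Let $\mathcal{K}=\{1,\dots,K\}$, $\mathbb{F}_q^{\times}=\mathbb{F}_q\setminus\{0\}$ and $L=l\log_2 q$. Let $\mathcal{S}$ be the set of all $M$-subsets of $\mathcal{K}$ and $\mathcal{C}$ the set of all length-$M$ sequences over $\mathbb{F}_q^{\times}$. Boldface denotes random variables, regular letters their realizations; entropies are in bits. A server stores messages $\mathbf{X}_1,\dots,\mathbf{X}_K$, i.i.d. uniform on $\mathbb{F}_{q^l}$; write $\mathbf{X}_{\mathcal{K}}=\{\mathbf{X}_1,\dots,\mathbf{X}_K\}$. A user wants $X_W$ ($W\in\mathcal{K}$) and knows $Y^{[S,C]}=\sum_{i\in S}c_iX_i$, where $S=\{i_1,\dots,i_M\}\in\mathcal{S}$ and $C=(c_{i_1},\dots,c_{i_M})\in\mathcal{C}$. $\mathbf{S}$ is uniform on $\mathcal{S}$, $\mathbf{C}$ is uniform on $\mathcal{C}$ and independent of $(\mathbf{W},\mathbf{S})$, and the messages are independent of $(\mathbf{W},\mathbf{S},\mathbf{C})$. Model I: given $\mathbf{S}=S$, $\mathbf{W}$ is uniform on $\mathcal{K}\setminus S$ (so $\mathds{1}_{\{\mathbf{W}\in\mathbf{S}\}}=0$). A protocol consists of a query $\mathbf{Q}$,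 a possibly stochastic function of $(\mathbf{W},\mathbf{S},\mathbf{C})$ only (extra randomness independent of the messages), and an answer $\mathbf{A}$, a deterministic function of $\mathbf{Q}$, $\mathds{1}_{\{\mathbf{W}\in\mathbf{S}\}}$ and $\mathbf{X}_{\mathcal{K}}$. It is a PIR-CSI--I protocol if, under Model I, it satisfies recoverability, $H(\mathbf{X}_{\mathbf{W}}\mid \mathbf{A},\mathbf{Q},\mathds{1}_{\{\mathbf{W}\in\mathbf{S}\}},\mathbf{Y}^{[\mathbf{S},\mathbf{C}]},\mathbf{W},\mathbf{S},\mathbf{C})=0$, and $W$-privacy, $I(\mathbf{W};\mathbf{Q}\mid \mathds{1}_{\{\mathbf{W}\in\mathbf{S}\}})=0$ (equivalently, for every query $Q$ of positive probability the conditional distribution of $\mathbf{W}$ given $\mathbf{Q}=Q$ is uniform on $\mathcal{K}$). Its rate is $L/H(\mathbf{A}\mid \mathds{1}_{\{\mathbf{W}\in\mathbf{S}\}}=0)$. It is scalar-linear if the answer consists only of linear combinations of $X_1,\dots,X_K$ with coefficients in $\mathbb{F}_q$. MPC protocol. Let $n=\lceil K/(M+1)\rceil$. Define ordered index lists of length $M+1$: $I_i=((i-1)(M+1)+1,\dots,i(M+1))$ for $1\le i\le n-1$, and $I_n=((n-1)(M+1)+1,\dots,K,1,\dots,n(M+1)-K)$ (which is just $((n-1)(M+1)+1,\dots,K)$ if $M+1$ divides $K$). Step 1: given $W,S,C$, the user builds a random permutation $\pi$ of $\mathcal{K}$: choose $j^*$ uniformly from $\mathcal{K}$ and set $\pi(j^*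 )=W$; let $i^*=\lceil j^*/(M+1)\rceil$, the smallest $i$ with $j^*\in I_i$; assign the elements of $S$ uniformly at random (bijectively) to the positions $I_{i^*}\setminus\{j^*\}$, and the elements of $\mathcal{K}\setminus(\{W\}\cup S)$ uniformly at random (bijectively) to the positions $\mathcal{K}\setminus I_{i^*}$. Let $U_i=(\pi(j))_{j\in I_i}$ (in the order of $I_i$) for $1\le i\le n$, and $V=(c_{\pi(j)})_{j\in I_{i^*}}$ (in the order of $I_{i^*}$), where for $j\ne j^*$, $c_{\pi(j)}$ is the coefficient of $X_{\pi(j)}$ in $Y^{[S,C]}$, and $c_{\pi(j^* )}=c_W$ is chosen uniformly at random from $\mathbb{F}_q^\times$. All random choices are independent. The query is $Q=(Q_1,\dots,Q_n)$ with $Q_i=(U_i,V)$. Step 2: writing $U_i=(u_{i,1},\dots,u_{i,M+1})$ and $V=(b_1,\dots,b_{M+1})$, the server returns $A=(A_1,\dots,A_n)$ with $A_i=\sum_{j=1}^{M+1}b_jX_{u_{i,j}}$. Step 3: the user recovers $X_W$ by subtracting $Y^{[S,C]}$ from $A_{i^*}=c_WX_W+\sum_{i\in S}c_iX_i$ and dividing by $c_W$. *)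

theory Defs
  imports
    "HOL-Probability.Probability"
    "HOL-Algebra.Subrings"
    "HOL-Number_Theory.Prime_Powers"
begin

section \<open>Entropies, in bits, of random variables on a discrete probability space\<close>

text \<open>
  The sample space is cut down to the support of the distribution, so that random variables
  of finite support become simple functions even when their type is infinite. The information
  measures are those of HOL-Probability for base 2 and counting measures on the ranges.
\<close>

definition pmf_space :: "'w pmf \<Rightarrow> 'w measure" where
  "pmf_space p = restrict_space (measure_pmf p) (set_pmf p)"

definition entropy_bits :: "'w pmf \<Rightarrow> ('w \<Rightarrow> 'x) \<Rightarrow> real" where
  "entropy_bits p X = information_space.entropy_Pow (pmf_space p) 2 X"

definition cond_entropy_bits :: "'w pmf \<Rightarrow> ('w \<Rightarrow> 'x) \<Rightarrow> ('w \<Rightarrow> 'y) \<Rightarrow> real" where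
  "cond_entropy_bits p X Y = information_space.conditional_entropy_Pow (pmf_space p) 2 X Y"

definition cond_mutual_info_bits ::
    "'w pmf \<Rightarrow> ('w \<Rightarrow> 'x) \<Rightarrow> ('w \<Rightarrow> 'y) \<Rightarrow> ('w \<Rightarrow> 'z) \<Rightarrow> real" where
  "cond_mutual_info_bits p X Y Z =
     information_space.conditional_mutual_information_Pow (pmf_space p) 2 X Y Z"

lemma space_pmf_space [simp]: "space (pmf_space p) = set_pmf p"
  by (simp add: pmf_space_def space_restrict_space)

lemma information_space_pmf_space: "information_space (pmf_space p) 2"
proof -
  have "prob_space (pmf_space p)"
    unfolding pmf_space_def
    by (rule prob_space_restrict_space)
       (simp_all add: measure_pmf.emeasure_eq_measure measure_pmf.prob_eq_1 AE_measure_pmf)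
  then show ?thesis
    by (simp add: information_space_def information_space_axioms_def)
qed


section \<open>Private information retrieval with coded side information\<close>

text \<open>
  Throughout, \<open>E\<close> is the field of order \<open>q ^ l\<close> (an HOL-Algebra structure) and \<open>F\<close> the
  carrier of its subfield of order \<open>q\<close>.
\<close>

definition side_sets :: "nat \<Rightarrow> nat \<Rightarrow> nat set set" where
  "side_sets K M = {S. S \<subseteq> {1..K} \<and> card S = M}"

definition coeff_seqs :: "'a set \<Rightarrow> ('a, 'b) ring_scheme \<Rightarrow> nat \<Rightarrow> 'a list set" where
  "coeff_seqs F E M = {C. length C = M \<and> set C \<subseteq> F - {\<zero>\<^bsub>E\<^esub>}}"

text \<open>
  The elements \<open>i\<^sub>1, \<dots>, i\<^sub>M\<close> of \<open>S\<close> are listed in increasing order, and the coefficient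
  of \<open>i \<in> S\<close> is the entry of \<open>C\<close> at the position of \<open>i\<close> in that list.
\<close>

definition coeff_at :: "nat set \<Rightarrow> 'a list \<Rightarrow> nat \<Rightarrow> 'a" where
  "coeff_at S C i = C ! card {j \<in> S. j < i}"

definition side_info ::
    "('a, 'b) ring_scheme \<Rightarrow> nat set \<Rightarrow> 'a list \<Rightarrow> (nat \<Rightarrow> 'a) \<Rightarrow> 'a" where
  "side_info E S C X = (\<Oplus>\<^bsub>E\<^esub>i\<in>S. coeff_at S C i \<otimes>\<^bsub>E\<^esub> X i)"

text \<open>
  A query depends stochastically on \<open>W\<close>, \<open>S\<close> and \<open>C\<close>; an answer depends deterministically
  on the query, on the truth value of \<open>W \<in> S\<close>, and on the messages.
\<close>

record ('a, 'q, 'r) protocol =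
  query :: "nat \<Rightarrow> nat set \<Rightarrow> 'a list \<Rightarrow> 'q pmf"
  answer :: "'q \<Rightarrow> bool \<Rightarrow> (nat \<Rightarrow> 'a) \<Rightarrow> 'r"

record ('a, 'q) outcome =
  rv_W :: nat
  rv_S :: "nat set"
  rv_C :: "'a list"
  rv_X :: "nat \<Rightarrow> 'a"
  rv_Q :: 'q

definition rv_ind :: "('a, 'q) outcome \<Rightarrow> bool" where
  "rv_ind \<omega> \<longleftrightarrow> rv_W \<omega> \<in> rv_S \<omega>"

definition rv_Y :: "('a, 'b) ring_scheme \<Rightarrow> ('a, 'q) outcome \<Rightarrow> 'a" where
  "rv_Y E \<omega> = side_info E (rv_S \<omega>) (rv_C \<omega>) (rv_X \<omega>)"

definition rv_A :: "('a, 'q, 'r) protocol \<Rightarrow> ('a, 'q) outcome \<Rightarrow> 'r" where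
  "rv_A P \<omega> = answer P (rv_Q \<omega>) (rv_ind \<omega>) (rv_X \<omega>)"

text \<open>
  A tuple of messages is a function on \<open>{1..K}\<close>, with the fixed value \<open>undefined\<close> elsewhere.
\<close>

definition model_I ::
    "'a set \<Rightarrow> ('a, 'b) ring_scheme \<Rightarrow> nat \<Rightarrow> nat \<Rightarrow> ('a, 'q, 'r) protocol
      \<Rightarrow> ('a, 'q) outcome pmf" where
  "model_I F E K M P = do {
     S \<leftarrow> pmf_of_set (side_sets K M);
     W \<leftarrow> pmf_of_set ({1..K} - S);
     C \<leftarrow> pmf_of_set (coeff_seqs F E M);
     X \<leftarrow> Pi_pmf {1..K} undefined (\<lambda>_. pmf_of_set (carrier E));
     Q \<leftarrow> query P W S C;
     return_pmf \<lparr>rv_W = W, rv_S = S, rv_C = C, rv_X = X, rv_Q = Q\<rparr>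
   }"

definition recoverable_I ::
    "'a set \<Rightarrow> ('a, 'b) ring_scheme \<Rightarrow> nat \<Rightarrow> nat \<Rightarrow> ('a, 'q, 'r) protocol \<Rightarrow> bool" where
  "recoverable_I F E K M P \<longleftrightarrow>
     cond_entropy_bits (model_I F E K M P)
       (\<lambda>\<omega>. rv_X \<omega> (rv_W \<omega>))
       (\<lambda>\<omega>. (rv_A P \<omega>, rv_Q \<omega>, rv_ind \<omega>, rv_Y E \<omega>, rv_W \<omega>, rv_S \<omega>, rv_C \<omega>)) = 0"

definition W_private_I ::
    "'a set \<Rightarrow> ('a, 'b) ring_scheme \<Rightarrow> nat \<Rightarrow> nat \<Rightarrow> ('a, 'q, 'r) protocol \<Rightarrow> bool" where
  "W_private_I F E K M P \<longleftrightarrow>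
     cond_mutual_info_bits (model_I F E K M P) rv_W rv_Q rv_ind = 0"

definition PIR_CSI_I ::
    "'a set \<Rightarrow> ('a, 'b) ring_scheme \<Rightarrow> nat \<Rightarrow> nat \<Rightarrow> ('a, 'q, 'r) protocol \<Rightarrow> bool" where
  "PIR_CSI_I F E K M P \<longleftrightarrow> recoverable_I F E K M P \<and> W_private_I F E K M P"

text \<open>The numerator is the entropy of a single message, in bits.\<close>

definition rate_I ::
    "nat \<Rightarrow> nat \<Rightarrow> 'a set \<Rightarrow> ('a, 'b) ring_scheme \<Rightarrow> nat \<Rightarrow> nat
      \<Rightarrow> ('a, 'q, 'r) protocol \<Rightarrow> real" where
  "rate_I q l F E K M P =
     (real l * log 2 (real q)) /
     entropy_bits (cond_pmf (model_I F E K M P) {\<omega>. \<not> rv_ind \<omega>}) (rv_A P)"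

text \<open>
  For each query that can be asked under Model I, every component of the answer is a linear
  combination of the messages; the coefficients, taken from \<open>F\<close>, do not depend on the messages.
\<close>

definition scalar_linear_I ::
    "'a set \<Rightarrow> ('a, 'b) ring_scheme \<Rightarrow> nat \<Rightarrow> nat \<Rightarrow> ('a, 'q, 'a list) protocol \<Rightarrow> bool" where
  "scalar_linear_I F E K M P \<longleftrightarrow>
     (\<forall>S \<in> side_sets K M. \<forall>W \<in> {1..K} - S. \<forall>C \<in> coeff_seqs F E M. \<forall>Q \<in> set_pmf (query P W S C).
        \<exists>gs. set gs \<subseteq> {1..K} \<rightarrow> F \<and>
          (\<forall>X \<in> {1..K} \<rightarrow> carrier E.
             answer P Q (W \<in> S) X = map (\<lambda>g. \<Oplus>\<^bsub>E\<^esub>i\<in>{1..K}. g i \<otimes>\<^bsub>E\<^esub> X i) gs))"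


section \<open>The Modified Partition-and-Code protocol\<close>

definition num_blocks :: "nat \<Rightarrow> nat \<Rightarrow> nat" where
  "num_blocks K M = nat \<lceil>real K / real (M + 1)\<rceil>"

definition block :: "nat \<Rightarrow> nat \<Rightarrow> nat \<Rightarrow> nat list" where
  "block K M i =
     (let n = num_blocks K M in
      if i < n then [(i - 1) * (M + 1) + 1 ..< i * (M + 1) + 1]
      else [(n - 1) * (M + 1) + 1 ..< K + 1] @ [1 ..< n * (M + 1) - K + 1])"

definition bijections :: "nat set \<Rightarrow> nat set \<Rightarrow> (nat \<Rightarrow> nat) set" where
  "bijections A B = {f \<in> extensional A. bij_betw f A B}"

text \<open>
  \<open>j'\<close> is the position of \<open>W\<close>, and \<open>i'\<close> the first block containing \<open>j'\<close> (the last block may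
  wrap around to the beginning). Only meaningful for \<open>W \<in> {1..K} - S\<close>: otherwise a set of
  bijections below is empty.
\<close>

definition mpc_query ::
    "'a set \<Rightarrow> ('a, 'b) ring_scheme \<Rightarrow> nat \<Rightarrow> nat \<Rightarrow> nat \<Rightarrow> nat set \<Rightarrow> 'a list
      \<Rightarrow> (nat list \<times> 'a list) list pmf" where
  "mpc_query F E K M W S C = do {
     j' \<leftarrow> pmf_of_set {1..K};
     let i' = nat \<lceil>real j' / real (M + 1)\<rceil>;
     let I' = set (block K M i');
     \<sigma> \<leftarrow> pmf_of_set (bijections (I' - {j'}) S);
     \<tau> \<leftarrow> pmf_of_set (bijections ({1..K} - I') ({1..K} - ({W} \<union> S)));
     cW \<leftarrow> pmf_of_set (F - {\<zero>\<^bsub>E\<^esub>});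
     let \<pi> = (\<lambda>j. if j = j' then W else if j \<in> I' then \<sigma> j else \<tau> j);
     let V = map (\<lambda>j. if j = j' then cW else coeff_at S C (\<pi> j)) (block K M i');
     return_pmf (map (\<lambda>i. (map \<pi> (block K M i), V)) [1 ..< num_blocks K M + 1])
   }"

definition mpc_answer ::
    "('a, 'b) ring_scheme \<Rightarrow> nat \<Rightarrow> (nat list \<times> 'a list) list \<Rightarrow> bool \<Rightarrow> (nat \<Rightarrow> 'a) \<Rightarrow> 'a list" where
  "mpc_answer E M Q ind X =
     map (\<lambda>(U, V). \<Oplus>\<^bsub>E\<^esub>j\<in>{..<M + 1}. V ! j \<otimes>\<^bsub>E\<^esub> X (U ! j)) Q"

definition mpc ::
    "'a set \<Rightarrow> ('a, 'b) ring_scheme \<Rightarrow> nat \<Rightarrow> nat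
      \<Rightarrow> ('a, (nat list \<times> 'a list) list, 'a list) protocol" where
  "mpc F E K M = \<lparr>query = mpc_query F E K M, answer = mpc_answer E M\<rparr>"

end

theory Submission
  imports Defs
begin

text \<open>
  Let \<open>\<pi>\<close> be the permutation of positions built by the user, \<open>j\<close> the position of the demand and
  \<open>V\<close> the vector of coefficients. Given \<open>j\<close>, the data \<open>(S, W, \<sigma>, \<tau>)\<close> correspond bijectively to
  \<open>\<pi>\<close>, and given these, \<open>(C, c)\<close> correspond bijectively to \<open>V\<close>. Hence \<open>(j, \<pi>, V)\<close> is uniform;
  the query is a function of \<open>(\<pi>, V)\<close> alone, and \<open>W = \<pi> j\<close> with \<open>j\<close> uniform and independent of
  \<open>(\<pi>, V)\<close>, so the query reveals nothing about \<open>W\<close>. Every block, even if the last one wraps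
  around, contains a position lying in no other block. For a fixed query the answers are
  therefore linearly independent combinations of the messages, so they are jointly uniform and
  their entropy is the number of blocks times that of a message.
\<close>

section \<open>Information measures of finite-support distributions\<close>

text \<open>The model draws S, W, C and the messages before the position \<open>j\<close>, the maps
  \<sigma>, \<tau> and the coefficient \<open>c\<close>. The uniform law of
  \<open>(j, \<pi>, V)\<close> becomes visible only in another order, with \<open>j\<close> in front
  and \<open>C\<close> next to \<open>c\<close>. Privacy is therefore proved by exchanging draws
  that do not refer to each other, and no probability of a query is ever computed. Two coincidences
  make the reordered draws uniform: every pair S, W is completed to a permutation in the same number
  of ways, M! (K - M - 1)!, and the coefficient of the demand ranges over the same set as those in
  the side information. The wrapped block does not disturb this, since the argument fixes
  \<open>j\<close> and then works for any set of M + 1 positions that contains it. The wrap matters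
  for the rate: blocks may overlap, so independence of the answers cannot come from disjoint sets of
  messages. Under Model I the indicator is constantly false, so conditioning on it changes nothing
  and privacy is plain independence of W and Q.\<close>

lemma simple_distributed_pmf_space:
  assumes "finite (set_pmf p)"
  shows "simple_distributed (pmf_space p) X (pmf (map_pmf X p))"
proof -
  interpret information_space "pmf_space p" 2
    by (rule information_space_pmf_space)
  show ?thesis
  proof (rule simple_distributedI)
    show "simple_function (pmf_space p) X"
      using assms by (auto simp: simple_function_def pmf_space_def sets_restrict_space
          space_restrict_space)
    show "pmf (map_pmf X p) x = measure (pmf_space p) (X -` {x} \<inter> space (pmf_space p))" for x
      by (simp add: pmf_map pmf_space_def space_restrict_space measure_restrict_space
          measure_Int_set_pmf)
  qed simp
qed

text \<open>Where Y determines X, the joint mass equals the mass of Y, so every term of the entropy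
  sum contains log 1. Recoverability thus becomes a statement about pairs of outcomes in the
  support.\<close>

lemma cond_entropy_bits_eq_0:
  assumes fin: "finite (set_pmf p)"
    and det: "\<And>\<omega> \<omega>'. \<omega> \<in> set_pmf p \<Longrightarrow> \<omega>' \<in> set_pmf p \<Longrightarrow> Y \<omega> = Y \<omega>' \<Longrightarrow> X \<omega> = X \<omega>'"
  shows "cond_entropy_bits p X Y = 0"
proof -
  interpret information_space "pmf_space p" 2
    by (rule information_space_pmf_space)
  have eq: "pmf (map_pmf (\<lambda>\<omega>. (X \<omega>, Y \<omega>)) p) (X \<omega>, Y \<omega>) = pmf (map_pmf Y p) (Y \<omega>)"
    if "\<omega> \<in> set_pmf p" for \<omega>
    unfolding pmf_map using det[OF _ that]
    by (intro measure_prob_cong_0) (auto simp only: set_pmf_iff vimage_def)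
  have "pmf (map_pmf (\<lambda>\<omega>. (X \<omega>, Y \<omega>)) p) (X \<omega>, Y \<omega>)
      * log 2 (pmf (map_pmf (\<lambda>\<omega>. (X \<omega>, Y \<omega>)) p) (X \<omega>, Y \<omega>) / pmf (map_pmf Y p) (Y \<omega>)) = 0"
    if "\<omega> \<in> set_pmf p" for \<omega>
    unfolding eq[OF that] by simp
  then have "(\<Sum>(x, y)\<in>(\<lambda>\<omega>. (X \<omega>, Y \<omega>)) ` space (pmf_space p).
      pmf (map_pmf (\<lambda>\<omega>. (X \<omega>, Y \<omega>)) p) (x, y)
      * log 2 (pmf (map_pmf (\<lambda>\<omega>. (X \<omega>, Y \<omega>)) p) (x, y) / pmf (map_pmf Y p) y)) = 0"
    by (intro sum.neutral ballI) (elim imageE, simp only: split_conv space_pmf_space)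
  then show ?thesis
    unfolding cond_entropy_bits_def
      conditional_entropy_eq[OF simple_distributed_pmf_space[OF fin]
          simple_distributed_pmf_space[OF fin]] by simp
qed

text \<open>Conditioning on a constant is vacuous, so a factorization of the unconditional law of
  (X, Y) is enough. With independence written as \<open>pair_pmf A B\<close>, a chain of identities
  between distributions can deliver it.\<close>

lemma cond_mutual_info_bits_eq_0:
  assumes fin: "finite (set_pmf p)"
    and Z: "\<And>\<omega>. \<omega> \<in> set_pmf p \<Longrightarrow> Z \<omega> = z"
    and XY: "map_pmf (\<lambda>\<omega>. (X \<omega>, Y \<omega>)) p = pair_pmf A B"
  shows "cond_mutual_info_bits p X Y Z = 0"
proof -
  interpret information_space "pmf_space p" 2
    by (rule information_space_pmf_space)
  have X: "map_pmf X p = A" and Y: "map_pmf Y p = B"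
    using arg_cong[OF XY, of "map_pmf fst"] arg_cong[OF XY, of "map_pmf snd"]
    by (simp_all add: map_pmf_comp map_fst_pair_pmf map_snd_pair_pmf)
  have const: "map_pmf (\<lambda>\<omega>. (f \<omega>, Z \<omega>)) p = map_pmf (\<lambda>x. (x, z)) (map_pmf f p)"
    for f :: "'a \<Rightarrow> 'e"
    using Z by (simp add: map_pmf_comp cong: map_pmf_cong)
  have PZ: "pmf (map_pmf Z p) z = 1"
    using Z by (simp add: map_pmf_const cong: map_pmf_cong)
  have inj: "inj (\<lambda>x. (x, z))" "inj (\<lambda>(x, y). (x, y, z))"
    by (auto simp: inj_def)
  have PXZ: "pmf (map_pmf (\<lambda>\<omega>. (X \<omega>, Z \<omega>)) p) (x, z) = pmf A x" for x
    unfolding const X using pmf_map_inj'[OF inj(1), of A x] by simp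
  have PYZ: "pmf (map_pmf (\<lambda>\<omega>. (Y \<omega>, Z \<omega>)) p) (y, z) = pmf B y" for y
    unfolding const Y using pmf_map_inj'[OF injI, of "\<lambda>x. (x, z)" B y] by simp
  have "map_pmf (\<lambda>\<omega>. (X \<omega>, Y \<omega>, Z \<omega>)) p = map_pmf (\<lambda>(x, y). (x, y, z)) (pair_pmf A B)"
    unfolding XY[symmetric] using Z by (simp add: map_pmf_comp cong: map_pmf_cong)
  then have PXYZ: "pmf (map_pmf (\<lambda>\<omega>. (X \<omega>, Y \<omega>, Z \<omega>)) p) (x, y, z) = pmf A x * pmf B y" for x y
    using pmf_map_inj'[OF injI, of "\<lambda>(x, y). (x, y, z)" "pair_pmf A B" "(x, y)"]
    by (auto simp: pmf_pair)
  have "pmf (map_pmf (\<lambda>\<omega>. (X \<omega>, Y \<omega>, Z \<omega>)) p) (X \<omega>, Y \<omega>, Z \<omega>)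
      * log 2 (pmf (map_pmf (\<lambda>\<omega>. (X \<omega>, Y \<omega>, Z \<omega>)) p) (X \<omega>, Y \<omega>, Z \<omega>)
          / (pmf (map_pmf (\<lambda>\<omega>. (X \<omega>, Z \<omega>)) p) (X \<omega>, Z \<omega>)
            * (pmf (map_pmf (\<lambda>\<omega>. (Y \<omega>, Z \<omega>)) p) (Y \<omega>, Z \<omega>) / pmf (map_pmf Z p) (Z \<omega>)))) = 0"
    if "\<omega> \<in> set_pmf p" for \<omega>
    \<comment> \<open>Either the quotient is 1 or the factor in front of the logarithm is 0.\<close>
    unfolding Z[OF that] PXYZ PXZ PYZ PZ by simp
  then show ?thesis
    unfolding cond_mutual_info_bits_def
      conditional_mutual_information_eq[OF simple_distributed_pmf_space[OF fin]
        simple_distributed_pmf_space[OF fin] simple_distributed_pmf_space[OF fin]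
        simple_distributed_pmf_space[OF fin]]
    by (intro sum.neutral ballI) (elim imageE, simp only: split_conv space_pmf_space)
qed

lemma entropy_bits_uniform:
  assumes fin: "finite (set_pmf p)" and A: "finite A" "A \<noteq> {}"
    and X: "map_pmf X p = pmf_of_set A"
  shows "entropy_bits p X = log 2 (card A)"
proof -
  interpret information_space "pmf_space p" 2
    by (rule information_space_pmf_space)
  have "X ` set_pmf p = A"
    using arg_cong[OF X, of set_pmf] A by simp
  moreover have "card A > 0"
    using A by (simp add: card_gt_0_iff)
  ultimately show ?thesis
    unfolding entropy_bits_def
    by (subst entropy_simple_distributed[OF simple_distributed_pmf_space[OF fin]])
      (simp add: X A log_divide)
qed

lemma pair_pmf_of_set:
  assumes "finite A" "A \<noteq> {}" "finite B" "B \<noteq> {}"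
  shows "pair_pmf (pmf_of_set A) (pmf_of_set B) = pmf_of_set (A \<times> B)"
proof (rule pmf_eqI)
  fix z
  show "pmf (pair_pmf (pmf_of_set A) (pmf_of_set B)) z = pmf (pmf_of_set (A \<times> B)) z"
    using assms by (cases z) (simp add: pmf_pair indicator_def)
qed

text \<open>Merges two successive draws into one from a product, so that uniformity can be carried
  along a bijection by \<open>map_pmf_of_set_bij_betw\<close>.\<close>

lemma pmf_of_set_bind_pair:
  assumes "finite A" "A \<noteq> {}" "finite B" "B \<noteq> {}"
  shows "pmf_of_set A \<bind> (\<lambda>a. pmf_of_set B \<bind> (\<lambda>b. return_pmf (f a b)))
       = map_pmf (\<lambda>(a, b). f a b) (pmf_of_set (A \<times> B))"
  by (simp add: pair_pmf_of_set[OF assms, symmetric] pair_pmf_def map_pmf_def bind_assoc_pmf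
      bind_return_pmf)


section \<open>Uniform permutations and coefficients\<close>

text \<open>Injectivity forces surjectivity between finite sets of equal size. In this form
  bijections can be counted as injections, whose falling product is then a factorial.\<close>

lemma bijections_eq_PiE:
  assumes "finite A" "finite B" "card A = card B"
  shows "bijections A B = {f \<in> A \<rightarrow>\<^sub>E B. inj_on f A}"
proof (intro Set.set_eqI iffI)
  fix f
  assume "f \<in> {f \<in> A \<rightarrow>\<^sub>E B. inj_on f A}"
  then have f: "f ` A \<subseteq> B" "inj_on f A" "f \<in> extensional A"
    by (auto simp: PiE_def)
  then have "f ` A = B"
    using assms by (intro card_subset_eq) (simp_all add: card_image)
  with f show "f \<in> bijections A B"
    by (simp add: bijections_def bij_betw_def)
qed (auto simp: bijections_def PiE_def bij_betw_def)

lemma finite_bijections: "finite A \<Longrightarrow> finite B \<Longrightarrow> finite (bijections A B)"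
  by (rule finite_subset[of _ "A \<rightarrow>\<^sub>E B"])
    (auto simp: bijections_def PiE_iff extensional_def dest: bij_betw_apply intro: finite_PiE)

lemma card_bijections:
  assumes "finite A" "finite B" "card A = card B"
  shows "card (bijections A B) = fact (card B)"
  using card_inj_on_subset_funcset[OF assms(1,2) order_refl] fact_prod_rev[where 'a = nat, of "card B"] assms
  by (simp add: bijections_eq_PiE lessThan_atLeast0)

lemma glue_bijections:
  assumes I: "I \<subseteq> A" "j \<in> I" and S: "S \<subseteq> A" "W \<in> A - S"
    and \<sigma>: "\<sigma> \<in> bijections (I - {j}) S" and \<tau>: "\<tau> \<in> bijections (A - I) (A - ({W} \<union> S))"
  defines "\<pi> \<equiv> \<lambda>i. if i = j then W else if i \<in> I then \<sigma> i else \<tau> i"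
  shows "\<pi> \<in> bijections A A" "\<pi> j = W" "\<pi> ` (I - {j}) = S"
proof -
  have b1: "bij_betw \<pi> (I - {j}) S"
    using \<sigma> by (subst bij_betw_cong[of _ _ \<sigma>]) (auto simp: bijections_def \<pi>_def)
  have b2: "bij_betw \<pi> (A - I) (A - ({W} \<union> S))"
    using \<tau> I(2) by (subst bij_betw_cong[of _ _ \<tau>]) (auto simp: bijections_def \<pi>_def)
  have "bij_betw \<pi> {j} {W}"
    by (simp add: bij_betw_def \<pi>_def)
  from bij_betw_combine[OF bij_betw_combine[OF this b1] b2]
  have "bij_betw \<pi> ({j} \<union> (I - {j}) \<union> (A - I)) ({W} \<union> S \<union> (A - ({W} \<union> S)))"
    using S by auto
  moreover have "{j} \<union> (I - {j}) \<union> (A - I) = A" "{W} \<union> S \<union> (A - ({W} \<union> S)) = A"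
    using S I by auto
  ultimately have "bij_betw \<pi> A A"
    by simp
  \<comment> \<open>Outside \<open>A\<close> the last branch applies, and there \<tau> is
    \<open>undefined\<close>.\<close>
  moreover have "\<pi> \<in> extensional A"
    using \<tau> I by (auto simp: bijections_def extensional_def \<pi>_def)
  ultimately show "\<pi> \<in> bijections A A"
    by (simp add: bijections_def)
  show "\<pi> j = W" "\<pi> ` (I - {j}) = S"
    using bij_betw_imp_surj_on[OF b1] by (simp_all add: \<pi>_def)
qed

text \<open>The two counts do not depend on S and W, which later makes the cells in
  \<open>random_permutation\<close> equally large; being factorials, they also show that the sets
  are not empty.\<close>

lemma permutation_stage_sets:
  assumes A: "finite A" and I: "I \<subseteq> A" "j \<in> I" "card I = Suc M"
    and S: "S \<subseteq> A" "card S = M" "W \<in> A - S"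
  shows "finite (bijections (I - {j}) S)"
    and "card (bijections (I - {j}) S) = fact M"
    and "finite (bijections (A - I) (A - ({W} \<union> S)))"
    and "card (bijections (A - I) (A - ({W} \<union> S))) = fact (card A - Suc M)"
proof -
  have fin: "finite I" "finite S" "finite (I - {j})" "finite (A - I)" "finite (A - ({W} \<union> S))"
    using A I S finite_subset by blast+
  have "card ({W} \<union> S) = Suc M"
    using S fin by simp
  then have c: "card (A - ({W} \<union> S)) = card A - Suc M" "card (A - I) = card A - Suc M"
    using I S fin by (simp_all add: card_Diff_subset)
  have c': "card (I - {j}) = card S"
    using I S fin by simp
  show "finite (bijections (I - {j}) S)" "finite (bijections (A - I) (A - ({W} \<union> S)))"
    by (intro finite_bijections fin)+
  show "card (bijections (I - {j}) S) = fact M"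
    using card_bijections[OF fin(3,2) c'] S by simp
  show "card (bijections (A - I) (A - ({W} \<union> S))) = fact (card A - Suc M)"
    using card_bijections[OF fin(4,5)] c by simp
qed

text \<open>A permutation \<pi> of \<open>A\<close> reveals its origin: W is \<open>\<pi> j\<close>,
  S is the image of \<open>I - {j}\<close>, and \<sigma>, \<tau> are restrictions. So the pairs (S,
  W) cut \<open>bijections A A\<close> into disjoint cells of one size, and a uniform element of a
  uniformly chosen cell is uniform on the union. The union is taken in two stages, over W for fixed
  S and then over S, as W is drawn from a set that depends on S.\<close>

lemma random_permutation:
  fixes A I :: "nat set"
  assumes A: "finite A" and I: "I \<subseteq> A" and j: "j \<in> I" and cI: "card I = Suc M"
  shows "do {
      S \<leftarrow> pmf_of_set {S. S \<subseteq> A \<and> card S = M};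
      W \<leftarrow> pmf_of_set (A - S);
      \<sigma> \<leftarrow> pmf_of_set (bijections (I - {j}) S);
      \<tau> \<leftarrow> pmf_of_set (bijections (A - I) (A - ({W} \<union> S)));
      return_pmf (\<lambda>i. if i = j then W else if i \<in> I then \<sigma> i else \<tau> i)
    } = pmf_of_set (bijections A A)"
proof -
  \<comment> \<open>The cell of all permutations that can arise from S and W.\<close>
  define R where "R S W = {\<pi> \<in> bijections A A. \<pi> j = W \<and> \<pi> ` (I - {j}) = S}" for S W
  define \<S> where "\<S> = {S. S \<subseteq> A \<and> card S = M}"
  have IA: "I \<subseteq> A" and jA: "j \<in> A" and fI: "finite I"
    using I j A finite_subset by auto
  have fR: "finite (R S W)" for S W
    using finite_bijections[OF A A] by (rule finite_subset[rotated]) (auto simp: R_def)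
  have stage: "pmf_of_set (bijections (I - {j}) S) \<bind> (\<lambda>\<sigma>.
      pmf_of_set (bijections (A - I) (A - ({W} \<union> S))) \<bind> (\<lambda>\<tau>.
      return_pmf (\<lambda>i. if i = j then W else if i \<in> I then \<sigma> i else \<tau> i))) = pmf_of_set (R S W)"
    and cR: "card (R S W) = fact M * fact (card A - Suc M)"
    if S: "S \<in> \<S>" and W: "W \<in> A - S" for S W
  proof -
    let ?\<sigma> = "bijections (I - {j}) S" and ?\<tau> = "bijections (A - I) (A - ({W} \<union> S))"
    let ?h = "\<lambda>(\<sigma>, \<tau>) i. if i = j then W else if i \<in> I then \<sigma> i else \<tau> i"
    have SA: "S \<subseteq> A" and cS: "card S = M"
      using S by (simp_all add: \<S>_def)
    note sets = permutation_stage_sets[OF A IA j cI SA cS W]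
    have "bij_betw ?h (?\<sigma> \<times> ?\<tau>) (R S W)"
    proof (rule bij_betw_byWitness[where f' = "\<lambda>\<pi>. (restrict \<pi> (I - {j}), restrict \<pi> (A - I))"])
      show "\<forall>a\<in>?\<sigma> \<times> ?\<tau>. (\<lambda>\<pi>. (restrict \<pi> (I - {j}), restrict \<pi> (A - I))) (?h a) = a"
        using j by (auto simp: bijections_def extensional_def fun_eq_iff)
      show "\<forall>\<pi>\<in>R S W. ?h (restrict \<pi> (I - {j}), restrict \<pi> (A - I)) = \<pi>"
        using j IA by (auto simp: R_def bijections_def extensional_def fun_eq_iff)
      show "?h ` (?\<sigma> \<times> ?\<tau>) \<subseteq> R S W"
      proof (rule image_subsetI)
        fix x assume "x \<in> ?\<sigma> \<times> ?\<tau>"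
        then obtain \<sigma> \<tau> where x: "x = (\<sigma>, \<tau>)" and "\<sigma> \<in> ?\<sigma>" "\<tau> \<in> ?\<tau>"
          by blast
        from glue_bijections[OF IA j SA W this(2,3)] show "?h x \<in> R S W"
          unfolding x R_def mem_Collect_eq split_conv by (intro conjI)
      qed
      show "(\<lambda>\<pi>. (restrict \<pi> (I - {j}), restrict \<pi> (A - I))) ` R S W \<subseteq> ?\<sigma> \<times> ?\<tau>"
      proof (rule image_subsetI)
        fix \<pi> assume \<pi>: "\<pi> \<in> R S W"
        have inj: "inj_on \<pi> A" and im: "\<pi> ` A = A" and pj: "\<pi> j = W" and pI: "\<pi> ` (I - {j}) = S"
          using \<pi> by (auto simp: R_def bijections_def bij_betw_def)
        have "\<pi> ` (A - I) = \<pi> ` A - \<pi> ` I"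
          using inj IA by (simp add: inj_on_image_set_diff)
        also have "\<pi> ` I = {W} \<union> S"
          using pj pI j by blast
        finally have "bij_betw \<pi> (A - I) (A - ({W} \<union> S))"
          using inj im by (auto simp: bij_betw_def intro: inj_on_subset)
        moreover have "bij_betw \<pi> (I - {j}) S"
          using pI inj IA by (auto simp: bij_betw_def intro: inj_on_subset)
        ultimately show "(restrict \<pi> (I - {j}), restrict \<pi> (A - I)) \<in> ?\<sigma> \<times> ?\<tau>"
          by (simp add: bijections_def)
      qed
    qed
    note bij = this
    have ne: "?\<sigma> \<noteq> {}" "?\<tau> \<noteq> {}"
      using sets(2,4) by (metis card.empty fact_nonzero)+
    show "pmf_of_set ?\<sigma> \<bind> (\<lambda>\<sigma>. pmf_of_set ?\<tau> \<bind> (\<lambda>\<tau>.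
      return_pmf (\<lambda>i. if i = j then W else if i \<in> I then \<sigma> i else \<tau> i))) = pmf_of_set (R S W)"
      unfolding pmf_of_set_bind_pair[OF sets(1) ne(1) sets(3) ne(2)]
      using bij ne sets(1,3) by (intro map_pmf_of_set_bij_betw) auto
    show "card (R S W) = fact M * fact (card A - Suc M)"
      unfolding bij_betw_same_card[OF bij, symmetric] card_cartesian_product
      using sets(2,4) by simp
  qed
  have neR: "R S W \<noteq> {}" if "S \<in> \<S>" "W \<in> A - S" for S W
    using cR[OF that] by (metis card.empty fact_nonzero mult_eq_0_iff)
  \<comment> \<open>Since \<open>I\<close> has M + 1 elements inside \<open>A\<close>, no M-subset
    exhausts \<open>A\<close>.\<close>
  have ne_W: "A - S \<noteq> {}" if "S \<in> \<S>" for S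
    using that card_mono[OF A IA] cI by (auto simp: \<S>_def)
  have UN_R: "(\<Union>W\<in>A - S. R S W) = {\<pi> \<in> bijections A A. \<pi> ` (I - {j}) = S}" for S
  proof -
    \<comment> \<open>Injectivity keeps \<open>\<pi> j\<close> away from the image of the rest of
      \<open>I\<close>, so each \<pi> has an admissible W.\<close>
    have "\<pi> j \<in> A - \<pi> ` (I - {j})" if "\<pi> \<in> bijections A A" for \<pi>
    proof -
      have "\<pi> j \<in> A" "inj_on \<pi> A"
        using that jA by (auto simp: bijections_def bij_betw_def)
      then show ?thesis
        using IA jA by (auto dest: inj_onD)
    qed
    then show ?thesis
      by (auto simp: R_def)
  qed
  have stage2: "pmf_of_set (A - S) \<bind> (\<lambda>W. pmf_of_set (R S W))
      = pmf_of_set {\<pi> \<in> bijections A A. \<pi> ` (I - {j}) = S}" if S: "S \<in> \<S>" for S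
    unfolding UN_R[symmetric]
    by (rule pmf_of_set_UN[symmetric])
      (use A fR neR cR S ne_W in \<open>auto simp: disjoint_family_on_def R_def\<close>)
  \<comment> \<open>The second use of \<open>pmf_of_set_UN\<close> again asks for cells of equal
    size, now indexed by S alone: each collects \<open>card A - M\<close> choices of W.\<close>
  have cS: "card {\<pi> \<in> bijections A A. \<pi> ` (I - {j}) = S}
      = (card A - M) * (fact M * fact (card A - Suc M))" if S: "S \<in> \<S>" for S
  proof -
    have "card (A - S) = card A - M"
      using S A by (subst card_Diff_subset) (auto simp: \<S>_def intro: finite_subset)
    then show ?thesis
      unfolding UN_R[symmetric]
      by (subst card_UN_disjoint) (use A fR cR S in \<open>auto simp: R_def\<close>)
  qed
  have UN_S: "(\<Union>S\<in>\<S>. {\<pi> \<in> bijections A A. \<pi> ` (I - {j}) = S}) = bijections A A"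
  proof -
    have "\<pi> ` (I - {j}) \<in> \<S>" if "\<pi> \<in> bijections A A" for \<pi>
    proof -
      have inj: "inj_on \<pi> (I - {j})" and sub: "\<pi> ` (I - {j}) \<subseteq> A"
        using that IA by (auto simp: bijections_def bij_betw_def intro: inj_on_subset)
      show ?thesis
        using card_image[OF inj] sub cI j fI by (simp add: \<S>_def)
    qed
    then show ?thesis
      by auto
  qed
  have "pmf_of_set \<S> \<bind> (\<lambda>S. pmf_of_set (A - S) \<bind> (\<lambda>W.
      pmf_of_set (bijections (I - {j}) S) \<bind> (\<lambda>\<sigma>.
      pmf_of_set (bijections (A - I) (A - ({W} \<union> S))) \<bind> (\<lambda>\<tau>.
      return_pmf (\<lambda>i. if i = j then W else if i \<in> I then \<sigma> i else \<tau> i)))))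
    = pmf_of_set \<S> \<bind> (\<lambda>S. pmf_of_set {\<pi> \<in> bijections A A. \<pi> ` (I - {j}) = S})"
  proof (rule bind_pmf_cong[OF refl])
    have *: "finite \<S>" "\<S> \<noteq> {}"
      using A obtain_subset_with_card_n[of M A] card_mono[OF A IA] cI by (auto simp: \<S>_def)
    fix S assume "S \<in> set_pmf (pmf_of_set \<S>)"
    then have S: "S \<in> \<S>"
      using * by simp
    show "pmf_of_set (A - S) \<bind> (\<lambda>W.
      pmf_of_set (bijections (I - {j}) S) \<bind> (\<lambda>\<sigma>.
      pmf_of_set (bijections (A - I) (A - ({W} \<union> S))) \<bind> (\<lambda>\<tau>.
      return_pmf (\<lambda>i. if i = j then W else if i \<in> I then \<sigma> i else \<tau> i))))
      = pmf_of_set {\<pi> \<in> bijections A A. \<pi> ` (I - {j}) = S}"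
      unfolding stage2[OF S, symmetric]
      using A ne_W[OF S] by (intro bind_pmf_cong refl stage S) simp
  qed
  also have "\<dots> = pmf_of_set (\<Union>S\<in>\<S>. {\<pi> \<in> bijections A A. \<pi> ` (I - {j}) = S})"
  proof (rule pmf_of_set_UN[symmetric])
    show "finite (\<Union>S\<in>\<S>. {\<pi> \<in> bijections A A. \<pi> ` (I - {j}) = S})"
      unfolding UN_S by (rule finite_bijections[OF A A])
    show "\<S> \<noteq> {}"
      using A obtain_subset_with_card_n[of M A] card_mono[OF A IA] cI by (auto simp: \<S>_def)
    show "{\<pi> \<in> bijections A A. \<pi> ` (I - {j}) = S} \<noteq> {}" if "S \<in> \<S>" for S
      using ne_W[OF that] neR[OF that] unfolding UN_R[symmetric] by auto
  qed (use cS in \<open>auto simp: disjoint_family_on_def\<close>)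
  finally show ?thesis
    unfolding UN_S unfolding \<S>_def .
qed

section \<open>Uniform coefficient vectors, with the coefficients of S listed by rank\<close>

lemma bij_betw_rank:
  fixes S :: "nat set"
  assumes "finite S"
  shows "bij_betw (\<lambda>i. card {j \<in> S. j < i}) S {..<card S}"
proof -
  have less: "card {j \<in> S. j < i} < card {j \<in> S. j < i'}" if "i \<in> S" "i < i'" for i i'
    using assms that by (intro psubset_card_mono) auto
  have inj: "inj_on (\<lambda>i. card {j \<in> S. j < i}) S"
  proof (rule inj_onI)
    fix a b
    assume "a \<in> S" "b \<in> S" "card {j \<in> S. j < a} = card {j \<in> S. j < b}"
    then show "a = b"
      using less[of a b] less[of b a] by (cases a b rule: linorder_cases) simp_all
  qed
  have "(\<lambda>i. card {j \<in> S. j < i}) ` S \<subseteq> {..<card S}"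
    using assms by (auto intro!: psubset_card_mono)
  then have "(\<lambda>i. card {j \<in> S. j < i}) ` S = {..<card S}"
    using inj by (intro card_subset_eq) (simp_all add: card_image)
  with inj show ?thesis
    by (simp add: bij_betw_def)
qed

lemma coeff_at_in_set:
  assumes "finite S" "card S = length C" "i \<in> S"
  shows "coeff_at S C i \<in> set C"
  using bij_betw_apply[OF bij_betw_rank[OF assms(1)] assms(3)] assms(2) by (simp add: coeff_at_def)

text \<open>Away from \<open>j\<close> the entries of the output are those of \<open>C\<close>,
  rearranged by \<pi> and by rank in \<open>S\<close>; at \<open>j\<close> stands \<open>c\<close>.
  Hence (C, c) is recovered from the output, and injectivity together with the common size
  \<open>card Fs ^ Suc M\<close> gives a bijection. As \<open>c\<close> comes from the same set
  \<open>Fs\<close>, the resulting law depends neither on \<open>j\<close> nor on \<pi>; this is why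
  the demand receives a random coefficient.\<close>

lemma random_coefficients:
  fixes b :: "nat list"
  assumes Fs: "finite Fs" "Fs \<noteq> {}" and b: "distinct b" "length b = Suc M" "j \<in> set b"
    and \<pi>: "bij_betw \<pi> (set b - {j}) S"
  shows "do {
      C \<leftarrow> pmf_of_set {C. length C = M \<and> set C \<subseteq> Fs};
      c \<leftarrow> pmf_of_set Fs;
      return_pmf (map (\<lambda>i. if i = j then c else coeff_at S C (\<pi> i)) b)
    } = pmf_of_set {V. length V = Suc M \<and> set V \<subseteq> Fs}"
proof -
  let ?C = "{C. length C = M \<and> set C \<subseteq> Fs}"
  let ?V = "{V. length V = Suc M \<and> set V \<subseteq> Fs}"
  let ?h = "\<lambda>(C, c). map (\<lambda>i. if i = j then c else coeff_at S C (\<pi> i)) b"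
  have lists: "{C. length C = m \<and> set C \<subseteq> Fs} = {C. set C \<subseteq> Fs \<and> length C = m}" for m
    by auto
  have fin: "finite {C. length C = m \<and> set C \<subseteq> Fs}" for m
    unfolding lists by (rule finite_lists_length_eq[OF Fs(1)])
  have card: "card {C. length C = m \<and> set C \<subseteq> Fs} = card Fs ^ m" for m
    unfolding lists by (rule card_lists_length_eq[OF Fs(1)])
  have ne: "?C \<noteq> {}"
    using Fs card[of M] by (metis card.empty card_eq_0_iff power_not_zero)
  have fS: "finite S" and cS: "card S = M"
    using bij_betw_finite[OF \<pi>] bij_betw_same_card[OF \<pi>] b distinct_card[OF b(1)] by simp_all
  note rank = bij_betw_rank[OF fS, unfolded cS]
  have inj: "inj_on ?h (?C \<times> Fs)"
  proof (rule inj_onI)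
    fix x y assume "x \<in> ?C \<times> Fs" "y \<in> ?C \<times> Fs" "?h x = ?h y"
    then obtain C c C' c' where xy: "x = (C, c)" "y = (C', c')"
      and len: "length C = M" "length C' = M"
      and "map (\<lambda>i. if i = j then c else coeff_at S C (\<pi> i)) b
         = map (\<lambda>i. if i = j then c' else coeff_at S C' (\<pi> i)) b"
      by auto
    then have eq: "\<forall>i\<in>set b. (if i = j then c else coeff_at S C (\<pi> i))
        = (if i = j then c' else coeff_at S C' (\<pi> i))"
      by simp
    \<comment> \<open>Entry k belongs to the element of S of rank k, and that element is
      \<open>\<pi> i\<close> for a position \<open>i\<close> of the list other than
      \<open>j\<close>.\<close>
    have "C ! k = C' ! k" if "k < M" for k
    proof -
      have "k \<in> (\<lambda>i. card {j \<in> S. j < i}) ` S"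
        using that bij_betw_imp_surj_on[OF rank] by simp
      then obtain s where "s \<in> S" and s: "k = card {j \<in> S. j < s}"
        by blast
      then obtain i where "i \<in> set b - {j}" "s = \<pi> i"
        using bij_betw_imp_surj_on[OF \<pi>] by auto
      then show ?thesis
        using eq by (auto simp: s coeff_at_def)
    qed
    then show "x = y"
      using len eq b(3) xy by (auto intro: nth_equalityI)
  qed
  have "?h ` (?C \<times> Fs) = ?V"
  proof (rule card_subset_eq[OF fin])
    show "?h ` (?C \<times> Fs) \<subseteq> ?V"
    proof clarify
      fix C c assume C: "set C \<subseteq> Fs" "M = length C" and c: "c \<in> Fs"
      have "coeff_at S C (\<pi> i) \<in> Fs" if "i \<in> set b" "i \<noteq> j" for i
      proof -
        have "\<pi> i \<in> S"
          using that \<pi> by (auto dest: bij_betw_apply)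
        then show ?thesis
          using coeff_at_in_set[OF fS] cS C by auto
      qed
      then show "length (map (\<lambda>i. if i = j then c else coeff_at S C (\<pi> i)) b) = Suc (length C)
        \<and> set (map (\<lambda>i. if i = j then c else coeff_at S C (\<pi> i)) b) \<subseteq> Fs"
        using b c C by auto
    qed
    show "card (?h ` (?C \<times> Fs)) = card ?V"
      by (simp only: card_image[OF inj] card_cartesian_product card) simp
  qed
  with inj have "bij_betw ?h (?C \<times> Fs) ?V"
    by (simp add: bij_betw_def)
  then show ?thesis
    unfolding pmf_of_set_bind_pair[OF fin ne Fs]
    using fin ne Fs by (intro map_pmf_of_set_bij_betw) auto
qed


section \<open>Blocks of positions\<close>

lemma nat_ceiling_divide:
  fixes a d :: nat
  assumes "0 < a" "0 < d"
  shows "1 \<le> nat \<lceil>real a / real d\<rceil>"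
    and "(nat \<lceil>real a / real d\<rceil> - 1) * d < a"
    and "a \<le> nat \<lceil>real a / real d\<rceil> * d"
proof -
  define i where "i = nat \<lceil>real a / real d\<rceil>"
  have pos: "0 < \<lceil>real a / real d\<rceil>"
    using assms by simp
  then show i1: "1 \<le> nat \<lceil>real a / real d\<rceil>"
    by linarith
  have "real i - 1 < real a / real d" "real a / real d \<le> real i"
    using ceiling_correct[of "real a / real d"] pos by (simp_all add: i_def)
  then have "(real i - 1) * real d < real a" "real a \<le> real i * real d"
    using assms by (simp_all add: field_simps)
  then have "real ((i - 1) * d) < real a" "real a \<le> real (i * d)"
    using i1 by (simp_all add: i_def of_nat_diff)
  then show "(nat \<lceil>real a / real d\<rceil> - 1) * d < a" "a \<le> nat \<lceil>real a / real d\<rceil> * d"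
    unfolding i_def of_nat_less_iff of_nat_le_iff .
qed

lemma nat_ceiling_divide_le:
  fixes a b d :: nat
  assumes "a \<le> b"
  shows "nat \<lceil>real a / real d\<rceil> \<le> nat \<lceil>real b / real d\<rceil>"
  using assms by (intro nat_mono ceiling_mono divide_right_mono) simp_all

text \<open>The end of each block before any wrapping. Ends are chosen because the wrap reuses
  positions from the start of the list, so first positions need not be private.\<close>

definition private_position :: "nat \<Rightarrow> nat \<Rightarrow> nat \<Rightarrow> nat" where
  "private_position K M i = (if i < num_blocks K M then i * (M + 1) else K)"

context
  fixes K M :: nat
  assumes KM: "M + 1 \<le> K"
begin

lemma num_blocks_bounds:
  "1 \<le> num_blocks K M" "(num_blocks K M - 1) * (M + 1) < K" "K \<le> num_blocks K M * (M + 1)"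
  using nat_ceiling_divide[of K "M + 1"] KM by (simp_all only: num_blocks_def)

lemma set_block_less:
  "i < num_blocks K M \<Longrightarrow> set (block K M i) = {(i - 1) * (M + 1) + 1..i * (M + 1)}"
  by (auto simp: block_def)

lemma set_block_last:
  "set (block K M (num_blocks K M))
    = {(num_blocks K M - 1) * (M + 1) + 1..K} \<union> {1..num_blocks K M * (M + 1) - K}"
  by (auto simp: block_def Let_def)

text \<open>Replaces the truncated difference \<open>num_blocks K M - 1\<close> by a variable: the
  last block starts right after \<open>n * (M + 1)\<close>, and its wrapped part has length
  \<open>(n + 1) * (M + 1) - K\<close>.\<close>

lemma num_blocks_eq_Suc:
  obtains n where "num_blocks K M = Suc n" "n * (M + 1) < K" "K \<le> n * (M + 1) + (M + 1)"
proof -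
  obtain n where "num_blocks K M = Suc n"
    using num_blocks_bounds(1) by (cases "num_blocks K M") auto
  then show ?thesis
    using num_blocks_bounds that[of n] by (simp add: algebra_simps)
qed

lemma length_block:
  assumes "i \<in> {1..num_blocks K M}"
  shows "length (block K M i) = M + 1"
proof -
  obtain n where n: "num_blocks K M = Suc n" "n * (M + 1) < K" "K \<le> n * (M + 1) + (M + 1)"
    by (rule num_blocks_eq_Suc)
  obtain k where k: "i = Suc k"
    using assms by (cases i) auto
  show ?thesis
    using n(2,3) by (auto simp: block_def n(1) k)
qed

text \<open>Only the last block could repeat a position. Its wrapped part ends at
  \<open>(n + 1) * (M + 1) - K\<close>, which is at most \<open>n * (M + 1)\<close> because
  \<open>M + 1 \<le> K\<close>, so it stops before the interval that opens the block.\<close>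

lemma distinct_block:
  assumes "i \<in> {1..num_blocks K M}"
  shows "distinct (block K M i)"
proof -
  obtain n where n: "num_blocks K M = Suc n" "n * (M + 1) < K" "K \<le> n * (M + 1) + (M + 1)"
    by (rule num_blocks_eq_Suc)
  show ?thesis
    using n(2,3) KM by (auto simp: block_def n(1))
qed

lemma set_block_subset:
  assumes "i \<in> {1..num_blocks K M}"
  shows "set (block K M i) \<subseteq> {1..K}"
proof (cases "i < num_blocks K M")
  case True
  then have "i * (M + 1) \<le> (num_blocks K M - 1) * (M + 1)"
    by (intro mult_le_mono1) simp
  then have "i * (M + 1) \<le> K"
    using num_blocks_bounds(2) by simp
  then show ?thesis
    unfolding set_block_less[OF True] by auto
next
  case False
  then have i: "i = num_blocks K M"
    using assms by simp
  obtain n where n: "num_blocks K M = Suc n" "n * (M + 1) < K" "K \<le> n * (M + 1) + (M + 1)"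
    by (rule num_blocks_eq_Suc)
  have "num_blocks K M * (M + 1) - K \<le> K"
    using n(2,3) KM by (simp add: n(1))
  then show ?thesis
    unfolding i set_block_last by auto
qed

text \<open>The ceiling finds \<open>j\<close> in the unwrapped interval of its block; in the last
  block that interval ends at K, which still bounds \<open>j\<close>. A wrapped position is thus
  attributed to the earlier block, as the choice of the smallest index demands.\<close>

lemma position_in_block:
  assumes "j \<in> {1..K}"
  shows "nat \<lceil>real j / real (M + 1)\<rceil> \<in> {1..num_blocks K M}"
    and "j \<in> set (block K M (nat \<lceil>real j / real (M + 1)\<rceil>))"
proof -
  define i where "i = nat \<lceil>real j / real (M + 1)\<rceil>"
  have i: "1 \<le> i" "(i - 1) * (M + 1) < j" "j \<le> i * (M + 1)"
    using nat_ceiling_divide[of j "M + 1"] assms by (simp_all only: i_def) simp_all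
  moreover have le: "i \<le> num_blocks K M"
    unfolding i_def num_blocks_def using assms by (intro nat_ceiling_divide_le) simp
  ultimately show "nat \<lceil>real j / real (M + 1)\<rceil> \<in> {1..num_blocks K M}"
    by (simp only: i_def) simp
  show "j \<in> set (block K M (nat \<lceil>real j / real (M + 1)\<rceil>))"
  proof (cases "i < num_blocks K M")
    case True
    then show ?thesis
      unfolding i_def[symmetric] set_block_less[OF True] atLeastAtMost_iff
      using i by linarith
  next
    case False
    then have eq: "i = num_blocks K M"
      using le by simp
    show ?thesis
      unfolding i_def[symmetric] eq set_block_last Un_iff atLeastAtMost_iff
      using i(2) assms unfolding eq atLeastAtMost_iff by linarith
  qed
qed

lemma private_position_in_block:
  assumes "i \<in> {1..num_blocks K M}"
  shows "private_position K M i \<in> set (block K M i)"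
proof (cases "i < num_blocks K M")
  case True
  moreover obtain k where "i = Suc k"
    using assms by (cases i) auto
  ultimately show ?thesis
    unfolding set_block_less[OF True] private_position_def by simp
next
  case False
  then have "i = num_blocks K M"
    using assms by simp
  then show ?thesis
    using num_blocks_bounds(2) by (simp add: set_block_last private_position_def)
qed

text \<open>A block other than the last contains no multiple of M + 1 but its own end, and it stays
  below K. The last block opens beyond all earlier ends, and its wrapped part has at most M
  positions, one short of the end of the first block.\<close>

lemma private_position_notin_block:
  assumes i: "i \<in> {1..num_blocks K M}" and k: "k \<in> {1..num_blocks K M}" and "i \<noteq> k"
  shows "private_position K M i \<notin> set (block K M k)"
proof -
  obtain n where n: "num_blocks K M = Suc n" "n * (M + 1) < K" "K \<le> n * (M + 1) + (M + 1)"
    by (rule num_blocks_eq_Suc)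
  show ?thesis
  proof (cases "k < num_blocks K M")
    case k': True
    show ?thesis
    proof (cases "i < num_blocks K M")
      case True
      show ?thesis
      proof (cases "i < k")
        case True
        then have "i * (M + 1) \<le> (k - 1) * (M + 1)"
          by (intro mult_le_mono1) simp
        then show ?thesis
          unfolding set_block_less[OF k'] using \<open>i < num_blocks K M\<close>
          by (simp add: private_position_def)
      next
        case False
        then have "(k + 1) * (M + 1) \<le> i * (M + 1)"
          using \<open>i \<noteq> k\<close> by (intro mult_le_mono1) simp
        then show ?thesis
          unfolding set_block_less[OF k'] using \<open>i < num_blocks K M\<close>
          by (simp add: private_position_def)
      qed
    next
      case False
      have "k * (M + 1) \<le> n * (M + 1)"
        using k' n(1) by (intro mult_le_mono1) simp
      then show ?thesis
        unfolding set_block_less[OF k'] using False n(2) by (simp add: private_position_def)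
    qed
  next
    case False
    then have k': "k = num_blocks K M" and i': "i < num_blocks K M"
      using i k \<open>i \<noteq> k\<close> by auto
    have "i * (M + 1) \<le> n * (M + 1)" "1 * (M + 1) \<le> i * (M + 1)"
      using i i' n(1) by (intro mult_le_mono1; simp)+
    \<comment> \<open>K exceeds \<open>n * (M + 1)\<close>, so at least one position of the last
      block is unwrapped.\<close>
    moreover have "num_blocks K M * (M + 1) - K \<le> M"
      using n(2,3) by (simp add: n(1))
    ultimately show ?thesis
      unfolding k' set_block_last using i' by (simp add: private_position_def n(1))
  qed
qed

end


section \<open>Linear images of uniform messages\<close>

text \<open>The row of the coding matrix that a block \<open>(U, V)\<close> contributes. It turns
  sums over positions in a block into sums over one index set common to all blocks.\<close>

definition coeff_row :: "('a, 'b) ring_scheme \<Rightarrow> nat list \<Rightarrow> 'a list \<Rightarrow> nat \<Rightarrow> 'a" where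
  "coeff_row E U V i = (case map_of (zip U V) i of None \<Rightarrow> \<zero>\<^bsub>E\<^esub> | Some c \<Rightarrow> c)"

lemma coeff_row_nth:
  "distinct U \<Longrightarrow> length V = length U \<Longrightarrow> k < length U \<Longrightarrow> coeff_row E U V (U ! k) = V ! k"
  by (simp add: coeff_row_def map_of_zip_nth)

lemma coeff_row_notin: "length V = length U \<Longrightarrow> i \<notin> set U \<Longrightarrow> coeff_row E U V i = \<zero>\<^bsub>E\<^esub>"
  by (metis coeff_row_def map_of_zip_is_None option.simps(4))

lemma coeff_row_in:
  assumes "distinct U" "length V = length U" "i \<in> set U"
  shows "coeff_row E U V i \<in> set V"
  using assms by (auto simp: in_set_conv_nth coeff_row_nth)

context field
begin

text \<open>Reindexing along \<open>U\<close> is legitimate because \<open>U\<close> is distinct;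
  enlarging the range from \<open>set U\<close> to \<open>A\<close> adds zero terms only.\<close>

lemma finsum_eq_coeff_row:
  assumes U: "distinct U" "length V = length U" "set U \<subseteq> A" and A: "finite A"
    and V: "set V \<subseteq> carrier R" and X: "X \<in> A \<rightarrow> carrier R"
  shows "(\<Oplus>k\<in>{..<length U}. V ! k \<otimes> X (U ! k)) = (\<Oplus>i\<in>A. coeff_row R U V i \<otimes> X i)"
proof -
  have inj: "inj_on ((!) U) {..<length U}"
    using U(1) by (simp add: inj_on_def nth_eq_iff_index_eq)
  have im: "(!) U ` {..<length U} = set U"
    by (auto simp: in_set_conv_nth)
  have carr: "coeff_row R U V i \<in> carrier R" for i
    using coeff_row_in[OF U(1,2), of i R] coeff_row_notin[OF U(2), of i R] V
    by (cases "i \<in> set U") auto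
  have "(\<Oplus>k\<in>{..<length U}. V ! k \<otimes> X (U ! k))
      = (\<Oplus>k\<in>{..<length U}. coeff_row R U V (U ! k) \<otimes> X (U ! k))"
    using U V X by (intro add.finprod_cong') (auto simp: coeff_row_nth Pi_iff subset_iff)
  also have "\<dots> = (\<Oplus>i\<in>set U. coeff_row R U V i \<otimes> X i)"
    using finsum_reindex[of "\<lambda>i. coeff_row R U V i \<otimes> X i" "(!) U" "{..<length U}"] inj carr X U(3)
    unfolding im by (force simp: Pi_iff)
  also have "\<dots> = (\<Oplus>i\<in>A. coeff_row R U V i \<otimes> X i)"
    using U A X carr
    by (intro add.finprod_mono_neutral_cong_left) (auto simp: coeff_row_notin Pi_iff)
  finally show ?thesis .
qed

text \<open>The columns \<open>p k\<close> form a diagonal matrix with nonzero diagonal, so once the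
  messages off these pivots are fixed, the k-th sum is an invertible affine function of the message
  at \<open>p k\<close> alone. Pairing the sums with the messages off the pivots gives a bijection
  onto a product, and the first component of a uniform pair is uniform.\<close>

lemma uniform_linear_image:
  assumes fin: "finite A" "finite (carrier R)"
    and g: "\<And>g. g \<in> set gs \<Longrightarrow> g \<in> A \<rightarrow> carrier R"
    and p: "\<And>k. k < length gs \<Longrightarrow> p k \<in> A" "\<And>k. k < length gs \<Longrightarrow> (gs ! k) (p k) \<noteq> \<zero>"
    and p0: "\<And>k m. k < length gs \<Longrightarrow> m < length gs \<Longrightarrow> k \<noteq> m \<Longrightarrow> (gs ! m) (p k) = \<zero>"
  shows "map_pmf (\<lambda>X. map (\<lambda>g. \<Oplus>i\<in>A. g i \<otimes> X i) gs) (pmf_of_set (A \<rightarrow>\<^sub>E carrier R))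
       = pmf_of_set {xs. set xs \<subseteq> carrier R \<and> length xs = length gs}"
proof -
  let ?n = "length gs"
  let ?L = "\<lambda>X. map (\<lambda>g. \<Oplus>i\<in>A. g i \<otimes> X i) gs"
  define P where "P = p ` {..<?n}"
  have injp: "inj_on p {..<?n}"
    using p p0 by (metis inj_onI lessThan_iff)
  have PA: "P \<subseteq> A"
    using p by (auto simp: P_def)
  have cP: "card P = ?n"
    by (simp add: P_def card_image[OF injp])
  let ?Y = "{xs. set xs \<subseteq> carrier R \<and> length xs = ?n} \<times> (A - P \<rightarrow>\<^sub>E carrier R)"
  have closed: "(\<Oplus>i\<in>B. g i \<otimes> X i) \<in> carrier R"
    if "g \<in> set gs" "X \<in> A \<rightarrow>\<^sub>E carrier R" "B \<subseteq> A" for g X B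
    using g[OF that(1)] that(2,3) by (intro finsum_closed) (auto simp: Pi_iff)
  have inj: "inj_on (\<lambda>X. (?L X, restrict X (A - P))) (A \<rightarrow>\<^sub>E carrier R)"
  proof (rule inj_onI)
    fix X X'
    assume X: "X \<in> A \<rightarrow>\<^sub>E carrier R" and X': "X' \<in> A \<rightarrow>\<^sub>E carrier R"
      and "(?L X, restrict X (A - P)) = (?L X', restrict X' (A - P))"
    then have eq: "?L X = ?L X'" and "restrict X (A - P) = restrict X' (A - P)"
      by (simp_all only: prod.inject)
    then have off: "X i = X' i" if "i \<in> A - P" for i
      using that restrict_apply'[OF that, of X] restrict_apply'[OF that, of X'] by simp
    have on: "X (p k) = X' (p k)" if k: "k < ?n" for k
    proof -
      let ?g = "gs ! k" and ?q = "p k"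
      have gk: "?g \<in> set gs"
        using k by simp
      then have gA: "?g \<in> A \<rightarrow> carrier R"
        by (rule g)
      have split: "(\<Oplus>i\<in>A. ?g i \<otimes> Z i) = ?g ?q \<otimes> Z ?q \<oplus> (\<Oplus>i\<in>A - {?q}. ?g i \<otimes> Z i)"
        if Z: "Z \<in> A \<rightarrow>\<^sub>E carrier R" for Z
        using finsum_insert[of "A - {?q}" ?q "\<lambda>i. ?g i \<otimes> Z i"] fin(1) Z gA p(1)[OF k]
        by (auto simp: insert_absorb Pi_iff)
      \<comment> \<open>Other pivots enter row k with coefficient zero, and off the pivots the two
        tuples agree.\<close>
      have rest: "(\<Oplus>i\<in>A - {?q}. ?g i \<otimes> X i) = (\<Oplus>i\<in>A - {?q}. ?g i \<otimes> X' i)"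
      proof (rule add.finprod_cong'[OF refl])
        show "(\<lambda>i. ?g i \<otimes> X' i) \<in> A - {?q} \<rightarrow> carrier R"
          using gA X' by (auto simp: Pi_iff)
        fix i assume i: "i \<in> A - {?q}"
        show "?g i \<otimes> X i = ?g i \<otimes> X' i"
        proof (cases "i \<in> P")
          case True
          then obtain m where "m < ?n" "i = p m"
            by (auto simp: P_def)
          then have "?g i = \<zero>"
            using p0[of m k] k i by auto
          moreover have "X i \<in> carrier R" "X' i \<in> carrier R"
            using X X' i by auto
          ultimately show ?thesis
            by simp
        next
          case False
          then show ?thesis
            using off i by simp
        qed
      qed
      have "(\<Oplus>i\<in>A. ?g i \<otimes> X i) = (\<Oplus>i\<in>A. ?g i \<otimes> X' i)"
        using eq gk by simp
      moreover have carr: "X ?q \<in> carrier R" "X' ?q \<in> carrier R" "?g ?q \<in> carrier R"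
        using X X' gA p(1)[OF k] by auto
      moreover have "(\<Oplus>i\<in>A - {?q}. ?g i \<otimes> X' i) \<in> carrier R"
        using closed[OF gk X'] by blast
      ultimately have "?g ?q \<otimes> X ?q = ?g ?q \<otimes> X' ?q"
        unfolding split[OF X] split[OF X'] rest by simp
      then show ?thesis
        using carr p(2)[OF k] by (simp add: m_lcancel)
    qed
    show "X = X'"
    proof (rule PiE_ext[OF X X'])
      fix i assume "i \<in> A"
      then show "X i = X' i"
        using off[of i] on by (cases "i \<in> P") (auto simp only: P_def)
    qed
  qed
  have fY: "finite ?Y"
    using fin by (intro finite_cartesian_product finite_lists_length_eq finite_PiE) auto
  have "(\<lambda>X. (?L X, restrict X (A - P))) ` (A \<rightarrow>\<^sub>E carrier R) = ?Y"
  proof (rule card_subset_eq[OF fY])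
    show "(\<lambda>X. (?L X, restrict X (A - P))) ` (A \<rightarrow>\<^sub>E carrier R) \<subseteq> ?Y"
      using closed by (auto simp: PiE_iff extensional_def)
    have "card ?Y = card (carrier R) ^ (?n + card (A - P))"
      using fin by (simp add: card_cartesian_product card_lists_length_eq card_PiE power_add)
    \<comment> \<open>Each pivot trades one message for one sum, so the two sides have equal size
      and injectivity gives surjectivity.\<close>
    also have "?n + card (A - P) = card A"
      using cP PA fin card_mono[OF fin(1) PA] finite_subset[OF PA fin(1)]
      by (simp add: card_Diff_subset)
    finally show "card ((\<lambda>X. (?L X, restrict X (A - P))) ` (A \<rightarrow>\<^sub>E carrier R)) = card ?Y"
      using fin by (simp add: card_image[OF inj] card_PiE)
  qed
  with inj have bij: "bij_betw (\<lambda>X. (?L X, restrict X (A - P))) (A \<rightarrow>\<^sub>E carrier R) ?Y"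
    by (simp add: bij_betw_def)
  have ne: "(A \<rightarrow>\<^sub>E carrier R) \<noteq> {}"
    "{xs. set xs \<subseteq> carrier R \<and> length xs = ?n} \<noteq> {}" "(A - P \<rightarrow>\<^sub>E carrier R) \<noteq> {}"
    using one_closed by (auto simp: PiE_eq_empty_iff intro!: exI[of _ "replicate ?n \<one>"])
  have "map_pmf ?L (pmf_of_set (A \<rightarrow>\<^sub>E carrier R))
      = map_pmf fst (map_pmf (\<lambda>X. (?L X, restrict X (A - P))) (pmf_of_set (A \<rightarrow>\<^sub>E carrier R)))"
    by (simp add: map_pmf_comp)
  also have "\<dots> = map_pmf fst (pmf_of_set ?Y)"
    using fin ne(1) by (subst map_pmf_of_set_bij_betw[OF bij]) (auto intro: finite_PiE)
  also have "\<dots> = pmf_of_set {xs. set xs \<subseteq> carrier R \<and> length xs = ?n}"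
    using fin ne
    by (subst pair_pmf_of_set[symmetric])
      (auto simp: map_fst_pair_pmf intro: finite_PiE finite_lists_length_eq)
  finally show ?thesis .
qed

end


section \<open>The protocol\<close>

locale mpc_scheme = field E for E :: "('a, 'b) ring_scheme" (structure) +
  fixes F :: "'a set" and K M :: nat
  assumes subfield: "subfield F E" and finite_carrier: "finite (carrier E)" and KM: "M + 1 \<le> K"
begin

abbreviation "nonzero \<equiv> F - {\<zero>}"

definition block_of :: "nat \<Rightarrow> nat list" where
  "block_of j = block K M (nat \<lceil>real j / real (M + 1)\<rceil>)"

definition mpc_queries :: "(nat \<Rightarrow> nat) \<Rightarrow> 'a list \<Rightarrow> (nat list \<times> 'a list) list" where
  "mpc_queries \<pi> V = map (\<lambda>i. (map \<pi> (block K M i), V)) [1..<num_blocks K M + 1]"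

section \<open>Finite and nonempty ranges of the random draws\<close>

lemma carrier_not_empty: "carrier E \<noteq> {}"
  using one_closed by blast

lemma F_subset: "F \<subseteq> carrier E"
  using subfield by (rule subfieldE(3))

lemma finite_nonzero: "finite nonzero" and nonzero_ne: "nonzero \<noteq> {}"
proof -
  show "finite nonzero"
    using F_subset finite_carrier finite_subset by blast
  have "\<one> \<in> F"
    using subringE(3)[OF subfieldE(1)[OF subfield]] .
  then show "nonzero \<noteq> {}"
    using one_not_zero by blast
qed

lemma coeff_seqs_eq: "coeff_seqs F E M = {C. length C = M \<and> set C \<subseteq> nonzero}"
  by (simp add: coeff_seqs_def)

lemma finite_lists: "finite {C. length C = m \<and> set C \<subseteq> nonzero}"
proof -
  have "{C. length C = m \<and> set C \<subseteq> nonzero} = {C. set C \<subseteq> nonzero \<and> length C = m}"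
    by auto
  then show ?thesis
    using finite_lists_length_eq[OF finite_nonzero] by simp
qed

lemma lists_ne: "{C. length C = m \<and> set C \<subseteq> nonzero} \<noteq> {}"
proof -
  obtain c where "c \<in> nonzero"
    using nonzero_ne by blast
  then have "replicate m c \<in> {C. length C = m \<and> set C \<subseteq> nonzero}"
    by auto
  then show ?thesis
    by blast
qed

lemma finite_side_sets: "finite (side_sets K M)" and side_sets_ne: "side_sets K M \<noteq> {}"
proof -
  show "finite (side_sets K M)"
    by (rule finite_subset[of _ "Pow {1..K}"]) (auto simp: side_sets_def)
  obtain S where "S \<subseteq> {1..K}" "card S = M"
    using obtain_subset_with_card_n[of M "{1..K}"] KM by auto
  then show "side_sets K M \<noteq> {}"
    by (auto simp: side_sets_def)
qed

lemma complement_ne: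
  assumes "S \<in> side_sets K M"
  shows "{1..K} - S \<noteq> {}"
  using assms KM card_mono[of S "{1..K}"] finite_subset[of S "{1..K}"] by (auto simp: side_sets_def)

lemma side_setD:
  assumes "S \<in> side_sets K M"
  shows "S \<subseteq> {1..K}" "card S = M" "finite S"
  using assms finite_subset[of S "{1..K}"] by (auto simp: side_sets_def)

lemma block_of:
  assumes "j \<in> {1..K}"
  shows "j \<in> set (block_of j)" "set (block_of j) \<subseteq> {1..K}" "distinct (block_of j)"
    "length (block_of j) = Suc M" "card (set (block_of j)) = Suc M"
proof -
  note i = position_in_block[OF KM assms]
  show "j \<in> set (block_of j)" "set (block_of j) \<subseteq> {1..K}" and d: "distinct (block_of j)"
    and l: "length (block_of j) = Suc M"
    using i set_block_subset[OF KM i(1)] distinct_block[OF KM i(1)] length_block[OF KM i(1)]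
    by (simp_all only: block_of_def)
  show "card (set (block_of j)) = Suc M"
    using distinct_card[OF d] l by simp
qed

lemma mpc_query_eq:
  "mpc_query F E K M W S C = do {
     j \<leftarrow> pmf_of_set {1..K};
     \<sigma> \<leftarrow> pmf_of_set (bijections (set (block_of j) - {j}) S);
     \<tau> \<leftarrow> pmf_of_set (bijections ({1..K} - set (block_of j)) ({1..K} - ({W} \<union> S)));
     c \<leftarrow> pmf_of_set nonzero;
     let \<pi> = (\<lambda>i. if i = j then W else if i \<in> set (block_of j) then \<sigma> i else \<tau> i);
     return_pmf (mpc_queries \<pi> (map (\<lambda>i. if i = j then c else coeff_at S C (\<pi> i)) (block_of j)))
   }"
  by (simp only: mpc_query_def mpc_queries_def block_of_def Let_def)

text \<open>\<open>pmf_of_set\<close> is specified only for finite nonempty sets, so both draws of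
  bijections have to be shown meaningful for W outside S.\<close>

lemma stage_sets:
  assumes "S \<in> side_sets K M" "W \<in> {1..K} - S" "j \<in> {1..K}"
  shows "finite (bijections (set (block_of j) - {j}) S)"
    and "bijections (set (block_of j) - {j}) S \<noteq> {}"
    and "finite (bijections ({1..K} - set (block_of j)) ({1..K} - ({W} \<union> S)))"
    and "bijections ({1..K} - set (block_of j)) ({1..K} - ({W} \<union> S)) \<noteq> {}"
proof -
  note sets = permutation_stage_sets[OF finite_atLeastAtMost block_of(2,1,5)[OF assms(3)]
      side_setD(1,2)[OF assms(1)] assms(2)]
  show "finite (bijections (set (block_of j) - {j}) S)"
    "finite (bijections ({1..K} - set (block_of j)) ({1..K} - ({W} \<union> S)))"
    by (rule sets)+
  show "bijections (set (block_of j) - {j}) S \<noteq> {}"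
    "bijections ({1..K} - set (block_of j)) ({1..K} - ({W} \<union> S)) \<noteq> {}"
    using sets(2,4) by (metis card.empty fact_nonzero)+
qed

lemma K_pos: "{1..K} \<noteq> {}"
  using KM by auto

text \<open>For recoverability, linearity and the law of the answer only the possible queries count,
  not their probabilities; each is described by one glued permutation in place of the pair \<sigma>,
  \<tau>.\<close>

lemma mpc_query_support:
  assumes S: "S \<in> side_sets K M" and W: "W \<in> {1..K} - S"
    and Q: "Q \<in> set_pmf (mpc_query F E K M W S C)"
  obtains j \<pi> c where "j \<in> {1..K}" "\<pi> \<in> bijections {1..K} {1..K}" "\<pi> j = W"
    "\<pi> ` (set (block_of j) - {j}) = S" "c \<in> nonzero"
    "Q = mpc_queries \<pi> (map (\<lambda>i. if i = j then c else coeff_at S C (\<pi> i)) (block_of j))"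
proof -
  from Q obtain j where j: "j \<in> {1..K}" and "Q \<in> set_pmf (do {
     \<sigma> \<leftarrow> pmf_of_set (bijections (set (block_of j) - {j}) S);
     \<tau> \<leftarrow> pmf_of_set (bijections ({1..K} - set (block_of j)) ({1..K} - ({W} \<union> S)));
     c \<leftarrow> pmf_of_set nonzero;
     let \<pi> = (\<lambda>i. if i = j then W else if i \<in> set (block_of j) then \<sigma> i else \<tau> i);
     return_pmf (mpc_queries \<pi> (map (\<lambda>i. if i = j then c else coeff_at S C (\<pi> i)) (block_of j)))
   })"
    unfolding mpc_query_eq set_bind_pmf[of "pmf_of_set {1..K}"]
      set_pmf_of_set[OF K_pos finite_atLeastAtMost] by blast
  then obtain \<sigma> \<tau> c where \<sigma>: "\<sigma> \<in> bijections (set (block_of j) - {j}) S"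
    and \<tau>: "\<tau> \<in> bijections ({1..K} - set (block_of j)) ({1..K} - ({W} \<union> S))" and c: "c \<in> nonzero"
    and Q: "Q = (let \<pi> = (\<lambda>i. if i = j then W else if i \<in> set (block_of j) then \<sigma> i else \<tau> i) in
     mpc_queries \<pi> (map (\<lambda>i. if i = j then c else coeff_at S C (\<pi> i)) (block_of j)))"
    unfolding set_bind_pmf set_return_pmf Let_def set_pmf_of_set[OF stage_sets(2,1)[OF S W j]]
      set_pmf_of_set[OF stage_sets(4,3)[OF S W j]] set_pmf_of_set[OF nonzero_ne finite_nonzero]
    by blast
  note \<pi> = glue_bijections[OF block_of(2,1)[OF j] side_setD(1)[OF S] W \<sigma> \<tau>]
  show ?thesis
    by (rule that[OF j \<pi> c Q[unfolded Let_def]])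
qed

lemma finite_mpc_query:
  assumes "S \<in> side_sets K M" "W \<in> {1..K} - S"
  shows "finite (set_pmf (mpc_query F E K M W S C))"
  unfolding mpc_query_eq Let_def set_bind_pmf
  using stage_sets[OF assms] finite_nonzero nonzero_ne K_pos
  by (intro finite_UN_I) (simp_all add: set_pmf_of_set)

section \<open>Answers as linear functions of the messages\<close>

lemma mpc_answer_eq:
  assumes \<pi>: "\<pi> \<in> bijections {1..K} {1..K}" and V: "length V = Suc M" "set V \<subseteq> F"
    and X: "X \<in> {1..K} \<rightarrow> carrier E"
  shows "mpc_answer E M (mpc_queries \<pi> V) ind X
    = map (\<lambda>g. \<Oplus>i\<in>{1..K}. g i \<otimes> X i)
        (map (\<lambda>i. coeff_row E (map \<pi> (block K M i)) V) [1..<num_blocks K M + 1])"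
proof -
  have "(\<Oplus>k\<in>{..<M + 1}. V ! k \<otimes> X (map \<pi> (block K M i) ! k))
      = (\<Oplus>x\<in>{1..K}. coeff_row E (map \<pi> (block K M i)) V x \<otimes> X x)"
    if i: "i \<in> {1..num_blocks K M}" for i
  proof -
    have inj: "inj_on \<pi> (set (block K M i))" and im: "\<pi> ` set (block K M i) \<subseteq> {1..K}"
      using \<pi> set_block_subset[OF KM i] by (auto simp: bijections_def bij_betw_def intro: inj_on_subset)
    have len: "length (map \<pi> (block K M i)) = M + 1"
      using length_block[OF KM i] by simp
    show ?thesis
      using finsum_eq_coeff_row[of "map \<pi> (block K M i)" V "{1..K}" X] X V F_subset
        inj im distinct_block[OF KM i] unfolding len by (simp add: distinct_map)
  qed
  then show ?thesis
    by (simp add: mpc_answer_def mpc_queries_def del: upt_Suc)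
qed

lemma mpc_query_support_lists:
  assumes S: "S \<in> side_sets K M" and W: "W \<in> {1..K} - S" and C: "C \<in> coeff_seqs F E M"
    and Q: "Q \<in> set_pmf (mpc_query F E K M W S C)"
  obtains \<pi> V where "\<pi> \<in> bijections {1..K} {1..K}" "length V = Suc M" "set V \<subseteq> nonzero"
    "Q = mpc_queries \<pi> V"
proof -
  from mpc_query_support[OF S W Q] obtain j \<pi> c where *: "j \<in> {1..K}" "\<pi> \<in> bijections {1..K} {1..K}"
    "\<pi> j = W" "\<pi> ` (set (block_of j) - {j}) = S" "c \<in> nonzero"
    "Q = mpc_queries \<pi> (map (\<lambda>i. if i = j then c else coeff_at S C (\<pi> i)) (block_of j))" .
  have "coeff_at S C (\<pi> i) \<in> nonzero" if "i \<in> set (block_of j)" "i \<noteq> j" for i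
    using coeff_at_in_set[OF side_setD(3)[OF S], of C "\<pi> i"] side_setD(2)[OF S] C that *(4)
    by (auto simp: coeff_seqs_def)
  then show ?thesis
    using * block_of(4)[OF *(1)] by (intro that[OF *(2) _ _ *(6)]) auto
qed

lemma coeff_row_in_F:
  assumes "distinct U" "length V = length U" "set V \<subseteq> F"
  shows "coeff_row E U V x \<in> F"
  using coeff_row_in[OF assms(1,2), of x E] coeff_row_notin[OF assms(2), of x E] assms(3)
    subringE(2)[OF subfieldE(1)[OF subfield]]
  by (cases "x \<in> set U") auto

lemma distinct_map_block:
  assumes "\<pi> \<in> bijections {1..K} {1..K}" "i \<in> {1..num_blocks K M}"
  shows "distinct (map \<pi> (block K M i))"
  using assms(1) set_block_subset[OF KM assms(2)] distinct_block[OF KM assms(2)]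
  by (auto simp: distinct_map bijections_def bij_betw_def intro: inj_on_subset)

lemma scalar_linear: "scalar_linear_I F E K M (mpc F E K M)"
  unfolding scalar_linear_I_def
proof (intro ballI)
  fix S W C Q
  assume A: "S \<in> side_sets K M" "W \<in> {1..K} - S" "C \<in> coeff_seqs F E M"
    and "Q \<in> set_pmf (query (mpc F E K M) W S C)"
  then have "Q \<in> set_pmf (mpc_query F E K M W S C)"
    by (simp add: mpc_def)
  then obtain \<pi> V where \<pi>: "\<pi> \<in> bijections {1..K} {1..K}" and V: "length V = Suc M" "set V \<subseteq> nonzero"
    and Q: "Q = mpc_queries \<pi> V"
    by (rule mpc_query_support_lists[OF A])
  have VF: "set V \<subseteq> F"
    using V by blast
  let ?gs = "map (\<lambda>i. coeff_row E (map \<pi> (block K M i)) V) [1..<num_blocks K M + 1]"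
  have "set ?gs \<subseteq> {1..K} \<rightarrow> F"
    using coeff_row_in_F[OF distinct_map_block[OF \<pi>] _ VF] V length_block[OF KM]
    by (auto simp del: upt_Suc)
  moreover have "answer (mpc F E K M) Q (W \<in> S) X = map (\<lambda>g. \<Oplus>i\<in>{1..K}. g i \<otimes> X i) ?gs"
    if "X \<in> {1..K} \<rightarrow> carrier E" for X
    using mpc_answer_eq[OF \<pi> V(1) VF that] by (auto simp: mpc_def Q)
  ultimately show "\<exists>gs. set gs \<subseteq> {1..K} \<rightarrow> F \<and> (\<forall>X\<in>{1..K} \<rightarrow> carrier E.
      answer (mpc F E K M) Q (W \<in> S) X = map (\<lambda>g. \<Oplus>i\<in>{1..K}. g i \<otimes> X i) gs)"
    by blast
qed

text \<open>The pivot of a block is the message that \<pi> puts on its private position. Its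
  coefficient in that block is an entry of V, hence nonzero; being injective, \<pi> keeps it out of
  every other block. Sharing V between the blocks does no harm, since only nonzero pivots
  matter.\<close>

lemma answer_uniform:
  assumes \<pi>: "\<pi> \<in> bijections {1..K} {1..K}" and V: "length V = Suc M" "set V \<subseteq> nonzero"
  shows "map_pmf (mpc_answer E M (mpc_queries \<pi> V) ind)
      (Pi_pmf {1..K} undefined (\<lambda>_. pmf_of_set (carrier E)))
    = pmf_of_set {xs. set xs \<subseteq> carrier E \<and> length xs = num_blocks K M}"
proof -
  define gs where "gs = map (\<lambda>i. coeff_row E (map \<pi> (block K M i)) V) [1..<num_blocks K M + 1]"
  \<comment> \<open>Rows are counted from 0, blocks from 1.\<close>
  define p where "p k = \<pi> (private_position K M (Suc k))" for k
  have len: "length gs = num_blocks K M"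
    by (simp add: gs_def)
  have gs: "gs ! k = coeff_row E (map \<pi> (block K M (Suc k))) V" if "k < num_blocks K M" for k
    using that by (simp add: gs_def nth_map_upt del: upt_Suc)
  have inj: "inj_on \<pi> {1..K}" and im: "\<pi> ` {1..K} = {1..K}"
    using \<pi> by (auto simp: bijections_def bij_betw_def)
  \<comment> \<open>With default value \<open>undefined\<close>, message tuples are exactly the
    extensional functions.\<close>
  have dflt: "PiE_dflt {1..K} undefined (\<lambda>_. carrier E) = {1..K} \<rightarrow>\<^sub>E carrier E"
    unfolding PiE_dflt_def PiE_def Pi_def extensional_def by blast
  have lenV: "length V = length (map \<pi> (block K M i))" if "i \<in> {1..num_blocks K M}" for i
    using length_block[OF KM that] V by simp
  have priv: "private_position K M (Suc k) \<in> {1..K}" if "k < num_blocks K M" for k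
    using private_position_in_block[OF KM, of "Suc k"] set_block_subset[OF KM, of "Suc k"] that by auto
  have "map_pmf (\<lambda>X. map (\<lambda>g. \<Oplus>i\<in>{1..K}. g i \<otimes> X i) gs) (pmf_of_set ({1..K} \<rightarrow>\<^sub>E carrier E))
      = pmf_of_set {xs. set xs \<subseteq> carrier E \<and> length xs = length gs}"
  proof (rule uniform_linear_image[of _ _ p])
    show "finite {1..K}" "finite (carrier E)"
      using finite_carrier by simp_all
    show "g \<in> {1..K} \<rightarrow> carrier E" if "g \<in> set gs" for g
    proof -
      have "coeff_row E (map \<pi> (block K M i)) V x \<in> carrier E" if "i \<in> {1..num_blocks K M}" for i x
        using coeff_row_in_F[OF distinct_map_block[OF \<pi> that] lenV[OF that]] V F_subset by blast
      then show ?thesis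
        using that by (auto simp: gs_def simp del: upt_Suc)
    qed
    show "p k \<in> {1..K}" if "k < length gs" for k
      using priv that im len by (auto simp: p_def)
    show "(gs ! k) (p k) \<noteq> \<zero>" if "k < length gs" for k
    proof -
      have k: "Suc k \<in> {1..num_blocks K M}"
        using that len by simp
      have "p k \<in> set (map \<pi> (block K M (Suc k)))"
        using private_position_in_block[OF KM k] by (simp add: p_def)
      then show ?thesis
        using coeff_row_in[OF distinct_map_block[OF \<pi> k] lenV[OF k]] V gs that len by fastforce
    qed
    show "(gs ! m) (p k) = \<zero>" if "k < length gs" "m < length gs" "k \<noteq> m" for k m
    proof -
      have k: "Suc k \<in> {1..num_blocks K M}" and m: "Suc m \<in> {1..num_blocks K M}"
        using that len by simp_all
      have "private_position K M (Suc k) \<notin> set (block K M (Suc m))"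
        using private_position_notin_block[OF KM k m] that by simp
      then have "p k \<notin> set (map \<pi> (block K M (Suc m)))"
        using inj_on_image_mem_iff[OF inj priv set_block_subset[OF KM m]] that len
        by (simp add: p_def)
      then show ?thesis
        using coeff_row_notin[OF lenV[OF m]] gs that len by simp
    qed
  qed
  moreover have "map_pmf (mpc_answer E M (mpc_queries \<pi> V) ind) (pmf_of_set ({1..K} \<rightarrow>\<^sub>E carrier E))
      = map_pmf (\<lambda>X. map (\<lambda>g. \<Oplus>i\<in>{1..K}. g i \<otimes> X i) gs) (pmf_of_set ({1..K} \<rightarrow>\<^sub>E carrier E))"
  proof (rule map_pmf_cong[OF refl])
    fix X assume "X \<in> set_pmf (pmf_of_set ({1..K} \<rightarrow>\<^sub>E carrier E))"
    moreover have "finite ({1..K} \<rightarrow>\<^sub>E carrier E)" "({1..K} \<rightarrow>\<^sub>E carrier E) \<noteq> {}"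
      using finite_carrier one_closed by (auto simp: PiE_eq_empty_iff intro: finite_PiE)
    ultimately have "X \<in> {1..K} \<rightarrow> carrier E"
      by auto
    then show "mpc_answer E M (mpc_queries \<pi> V) ind X = map (\<lambda>g. \<Oplus>i\<in>{1..K}. g i \<otimes> X i) gs"
      using mpc_answer_eq[OF \<pi> V(1), of X ind] V(2) unfolding gs_def by blast
  qed
  moreover have "Pi_pmf {1..K} undefined (\<lambda>_. pmf_of_set (carrier E))
      = pmf_of_set ({1..K} \<rightarrow>\<^sub>E carrier E)"
    unfolding dflt[symmetric] using finite_carrier carrier_not_empty by (intro Pi_pmf_of_set) simp_all
  ultimately show ?thesis
    by (simp only: len)
qed

text \<open>\<open>k\<close> and \<open>c\<close> are fixed before the messages are quantified, so
  one choice serves all message tuples compatible with the same query. The sum over the block of the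
  demand splits at W because the other entries of that block make up S.\<close>

lemma recover_witness:
  assumes S: "S \<in> side_sets K M" and W: "W \<in> {1..K} - S" and C: "C \<in> coeff_seqs F E M"
    and Q: "Q \<in> set_pmf (mpc_query F E K M W S C)"
  obtains k c where "c \<in> nonzero"
    "\<And>ind X. X \<in> {1..K} \<rightarrow> carrier E \<Longrightarrow>
       mpc_answer E M Q ind X ! k = c \<otimes> X W \<oplus> side_info E S C X"
proof -
  from mpc_query_support[OF S W Q] obtain j \<pi> c where j: "j \<in> {1..K}"
    and \<pi>: "\<pi> \<in> bijections {1..K} {1..K}"
    and pj: "\<pi> j = W" and pS: "\<pi> ` (set (block_of j) - {j}) = S" and c: "c \<in> nonzero"
    and Q: "Q = mpc_queries \<pi> (map (\<lambda>i. if i = j then c else coeff_at S C (\<pi> i)) (block_of j))" .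
  define v where "v = (\<lambda>i. if i = j then c else coeff_at S C (\<pi> i))"
  define U where "U = map \<pi> (block_of j)"
  define V where "V = map v (block_of j)"
  define i' where "i' = nat \<lceil>real j / real (M + 1)\<rceil>"
  have i': "i' \<in> {1..num_blocks K M}" and bi: "block K M i' = block_of j"
    using position_in_block(1)[OF KM j] by (simp_all only: i'_def block_of_def)
  have QV: "Q = mpc_queries \<pi> V"
    by (simp add: Q V_def v_def)
  have U: "distinct U" "length V = length U" "length U = M + 1"
    using distinct_map_block[OF \<pi> i'] block_of(4)[OF j] by (simp_all add: U_def V_def bi)
  have setU: "set U = insert W S"
    using pj pS block_of(1)[OF j] by (auto simp: U_def)
  have C_in: "coeff_at S C s \<in> nonzero" if "s \<in> S" for s
    using coeff_at_in_set[OF side_setD(3)[OF S], of C s] side_setD(2)[OF S] C that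
    by (auto simp: coeff_seqs_def)
  have row: "coeff_row E U V (\<pi> x) = v x" if x: "x \<in> set (block_of j)" for x
  proof -
    obtain k where "k < length (block_of j)" "x = block_of j ! k"
      using x by (auto simp: in_set_conv_nth)
    then show ?thesis
      using coeff_row_nth[OF U(1,2), of k E] by (simp add: U_def V_def)
  qed
  have rowW: "coeff_row E U V W = c"
    using row[OF block_of(1)[OF j]] pj by (simp add: v_def)
  have rowS: "coeff_row E U V s = coeff_at S C s" if "s \<in> S" for s
  proof -
    obtain x where x: "x \<in> set (block_of j) - {j}" "s = \<pi> x"
      using \<open>s \<in> S\<close> pS by blast
    then show ?thesis
      using row[of x] by (simp add: v_def)
  qed
  have C_carr: "coeff_at S C s \<in> carrier E" if "s \<in> S" for s
    using C_in[OF that] F_subset by blast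
  have setV: "set V \<subseteq> carrier E"
    using c C_in pS F_subset by (auto simp: V_def v_def)
  obtain m where m: "i' = Suc m" "m < num_blocks K M"
    using i' by (cases i') auto
  have Q_nth: "m < length Q" "Q ! m = (U, V)"
    using m by (simp_all add: QV mpc_queries_def U_def bi[symmetric] nth_map_upt del: upt_Suc)
  have "mpc_answer E M Q ind X ! m = c \<otimes> X W \<oplus> side_info E S C X"
    if X: "X \<in> {1..K} \<rightarrow> carrier E" for ind X
  proof -
    have XU: "X \<in> insert W S \<rightarrow> carrier E"
      using X W side_setD(1)[OF S] by auto
    have "mpc_answer E M Q ind X ! m = (\<Oplus>k\<in>{..<length U}. V ! k \<otimes> X (U ! k))"
      using Q_nth by (simp add: mpc_answer_def U(3))
    also have "\<dots> = (\<Oplus>i\<in>insert W S. coeff_row E U V i \<otimes> X i)"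
      using finsum_eq_coeff_row[OF U(1,2) _ _ setV XU] setU side_setD(3)[OF S] by simp
    also have "\<dots> = c \<otimes> X W \<oplus> (\<Oplus>i\<in>S. coeff_row E U V i \<otimes> X i)"
      using W XU side_setD(3)[OF S] c C_carr F_subset
      by (subst finsum_insert) (auto simp: rowW rowS)
    also have "(\<Oplus>i\<in>S. coeff_row E U V i \<otimes> X i) = side_info E S C X"
      unfolding side_info_def using XU C_carr
      by (intro add.finprod_cong') (auto simp: rowS)
    finally show ?thesis .
  qed
  then show ?thesis
    using that c by blast
qed

section \<open>Joint distribution under Model I and recoverability\<close>

lemma model_support:
  assumes "\<omega> \<in> set_pmf (model_I F E K M (mpc F E K M))"
  shows "rv_S \<omega> \<in> side_sets K M" "rv_W \<omega> \<in> {1..K} - rv_S \<omega>" "rv_C \<omega> \<in> coeff_seqs F E M"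
    "rv_X \<omega> \<in> {1..K} \<rightarrow> carrier E"
    "rv_Q \<omega> \<in> set_pmf (mpc_query F E K M (rv_W \<omega>) (rv_S \<omega>) (rv_C \<omega>))" "\<not> rv_ind \<omega>"
proof -
  have X: "set_pmf (Pi_pmf {1..K} undefined (\<lambda>_. pmf_of_set (carrier E))) \<subseteq> {1..K} \<rightarrow> carrier E"
    by (subst set_Pi_pmf)
      (auto simp: PiE_dflt_def set_pmf_of_set[OF carrier_not_empty finite_carrier])
  have "\<exists>S\<in>side_sets K M. \<exists>W\<in>set_pmf (pmf_of_set ({1..K} - S)). \<exists>C\<in>coeff_seqs F E M.
      \<exists>X\<in>set_pmf (Pi_pmf {1..K} undefined (\<lambda>_. pmf_of_set (carrier E))).
      \<exists>Q\<in>set_pmf (mpc_query F E K M W S C).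
        \<omega> = \<lparr>rv_W = W, rv_S = S, rv_C = C, rv_X = X, rv_Q = Q\<rparr>"
    using assms
    unfolding model_I_def set_bind_pmf set_return_pmf mpc_def protocol.simps
      set_pmf_of_set[OF side_sets_ne finite_side_sets]
      set_pmf_of_set[OF lists_ne[of M] finite_lists, folded coeff_seqs_eq]
    by (simp only: UN_iff singleton_iff)
  then obtain S W C X Q where \<omega>: "\<omega> = \<lparr>rv_W = W, rv_S = S, rv_C = C, rv_X = X, rv_Q = Q\<rparr>"
    and S: "S \<in> side_sets K M" and W: "W \<in> set_pmf (pmf_of_set ({1..K} - S))"
    and "C \<in> coeff_seqs F E M" and "X \<in> {1..K} \<rightarrow> carrier E"
    and "Q \<in> set_pmf (mpc_query F E K M W S C)"
    using X by blast
  moreover have "W \<in> {1..K} - S"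
    using W complement_ne[OF S] by simp
  ultimately show "rv_S \<omega> \<in> side_sets K M" "rv_W \<omega> \<in> {1..K} - rv_S \<omega>" "rv_C \<omega> \<in> coeff_seqs F E M"
    "rv_X \<omega> \<in> {1..K} \<rightarrow> carrier E"
    "rv_Q \<omega> \<in> set_pmf (mpc_query F E K M (rv_W \<omega>) (rv_S \<omega>) (rv_C \<omega>))" "\<not> rv_ind \<omega>"
    by (simp_all add: rv_ind_def)
qed

lemma finite_model: "finite (set_pmf (model_I F E K M (mpc F E K M)))"
proof -
  have X: "finite (set_pmf (Pi_pmf {1..K} undefined (\<lambda>_. pmf_of_set (carrier E))))"
    using finite_carrier
    by (subst set_Pi_pmf)
      (auto simp: set_pmf_of_set[OF carrier_not_empty finite_carrier] intro!: finite_PiE_dflt)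
  show ?thesis
    unfolding model_I_def set_bind_pmf set_return_pmf mpc_def protocol.simps
      set_pmf_of_set[OF side_sets_ne finite_side_sets]
      set_pmf_of_set[OF lists_ne[of M] finite_lists, folded coeff_seqs_eq]
  proof (intro finite_UN_I finite_side_sets X finite.emptyI finite.insertI)
    show "finite (coeff_seqs F E M)"
      unfolding coeff_seqs_eq by (rule finite_lists)
    fix S assume S: "S \<in> side_sets K M"
    show "finite (set_pmf (pmf_of_set ({1..K} - S)))"
      using complement_ne[OF S] by simp
    fix W C assume "W \<in> set_pmf (pmf_of_set ({1..K} - S))"
    then have "W \<in> {1..K} - S"
      using complement_ne[OF S] by simp
    then show "finite (set_pmf (mpc_query F E K M W S C))"
      by (rule finite_mpc_query[OF S])
  qed
qed

text \<open>Two outcomes that the user cannot tell apart share Q, W, S and C, hence also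
  \<open>k\<close> and \<open>c\<close>. Component \<open>k\<close> of the equal answers is a
  multiple of the demand by \<open>c\<close> plus the common side information; the latter cancels,
  and then \<open>c\<close> does, being nonzero.\<close>

lemma recoverable: "recoverable_I F E K M (mpc F E K M)"
  unfolding recoverable_I_def
proof (rule cond_entropy_bits_eq_0[OF finite_model])
  fix \<omega> \<omega>'
  assume \<omega>: "\<omega> \<in> set_pmf (model_I F E K M (mpc F E K M))"
    and \<omega>': "\<omega>' \<in> set_pmf (model_I F E K M (mpc F E K M))"
    and eq: "(rv_A (mpc F E K M) \<omega>, rv_Q \<omega>, rv_ind \<omega>, rv_Y E \<omega>, rv_W \<omega>, rv_S \<omega>, rv_C \<omega>)
      = (rv_A (mpc F E K M) \<omega>', rv_Q \<omega>', rv_ind \<omega>', rv_Y E \<omega>', rv_W \<omega>', rv_S \<omega>', rv_C \<omega>')"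
  note s = model_support[OF \<omega>] and s' = model_support[OF \<omega>']
  obtain k c where c: "c \<in> nonzero" and ans: "\<And>ind X. X \<in> {1..K} \<rightarrow> carrier E \<Longrightarrow>
      mpc_answer E M (rv_Q \<omega>) ind X ! k = c \<otimes> X (rv_W \<omega>) \<oplus> side_info E (rv_S \<omega>) (rv_C \<omega>) X"
    using recover_witness[OF s(1,2,3,5)] by metis
  from eq have e: "rv_A (mpc F E K M) \<omega> = rv_A (mpc F E K M) \<omega>'" "rv_Q \<omega>' = rv_Q \<omega>"
    "rv_ind \<omega>' = rv_ind \<omega>" "rv_Y E \<omega> = rv_Y E \<omega>'"
    "rv_W \<omega>' = rv_W \<omega>" "rv_S \<omega>' = rv_S \<omega>" "rv_C \<omega>' = rv_C \<omega>"
    by simp_all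
  have Y: "side_info E (rv_S \<omega>) (rv_C \<omega>) (rv_X \<omega>) = side_info E (rv_S \<omega>) (rv_C \<omega>) (rv_X \<omega>')"
    using e(4) by (simp only: rv_Y_def e(6,7))
  have A: "mpc_answer E M (rv_Q \<omega>) (rv_ind \<omega>) (rv_X \<omega>) = mpc_answer E M (rv_Q \<omega>) (rv_ind \<omega>) (rv_X \<omega>')"
    using e(1) by (simp only: rv_A_def mpc_def protocol.simps e(2,3))
  have carr: "c \<in> carrier E" "rv_X \<omega> (rv_W \<omega>) \<in> carrier E" "rv_X \<omega>' (rv_W \<omega>) \<in> carrier E"
    using c F_subset s(2,4) s'(4) by auto
  have "side_info E (rv_S \<omega>) (rv_C \<omega>) (rv_X \<omega>') \<in> carrier E"
    unfolding side_info_def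
  proof (rule finsum_closed, rule)
    fix i assume i: "i \<in> rv_S \<omega>"
    then have "coeff_at (rv_S \<omega>) (rv_C \<omega>) i \<in> set (rv_C \<omega>)"
      using side_setD(2,3)[OF s(1)] s(3) by (intro coeff_at_in_set) (auto simp: coeff_seqs_def)
    then have "coeff_at (rv_S \<omega>) (rv_C \<omega>) i \<in> carrier E"
      using s(3) F_subset by (auto simp: coeff_seqs_def)
    then show "coeff_at (rv_S \<omega>) (rv_C \<omega>) i \<otimes> rv_X \<omega>' i \<in> carrier E"
      using s'(4) i side_setD(1)[OF s(1)] by auto
  qed
  then have "c \<otimes> rv_X \<omega> (rv_W \<omega>) = c \<otimes> rv_X \<omega>' (rv_W \<omega>)"
    using ans[OF s(4), of "rv_ind \<omega>"] ans[OF s'(4), of "rv_ind \<omega>"] carr unfolding A Y by simp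
  then have "rv_X \<omega> (rv_W \<omega>) = rv_X \<omega>' (rv_W \<omega>)"
    using carr c by (simp add: m_lcancel)
  then show "rv_X \<omega> (rv_W \<omega>) = rv_X \<omega>' (rv_W \<omega>')"
    by (simp only: e(5))
qed

text \<open>The answer has the same uniform law for every possible query, so averaging over S, W, C
  and Q leaves that law unchanged. Its entropy is the logarithm of
  \<open>(q ^ l) ^ num_blocks K M\<close>.\<close>

lemma rate:
  assumes card: "card (carrier E) = q ^ l" and q: "2 \<le> q" and l: "1 \<le> l"
  shows "rate_I q l F E K M (mpc F E K M) = inverse (real (num_blocks K M))"
proof -
  let ?p = "model_I F E K M (mpc F E K M)"
  let ?A = "{xs. set xs \<subseteq> carrier E \<and> length xs = num_blocks K M}"
  let ?X = "Pi_pmf {1..K} undefined (\<lambda>_. pmf_of_set (carrier E))"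
  have sub: "set_pmf ?p \<subseteq> {\<omega>. \<not> rv_ind \<omega>}"
    using model_support(6) by blast
  \<comment> \<open>The condition has probability 1.\<close>
  have cond: "cond_pmf ?p {\<omega>. \<not> rv_ind \<omega>} = ?p"
  proof (rule pmf_eqI)
    fix \<omega>
    have "set_pmf ?p \<inter> {\<omega>. \<not> rv_ind \<omega>} \<noteq> {}"
      using sub set_pmf_not_empty[of ?p] by blast
    moreover have "measure_pmf.prob ?p {\<omega>. \<not> rv_ind \<omega>} = 1"
      using sub by (subst measure_pmf.prob_eq_1) (auto simp: AE_measure_pmf_iff)
    moreover have "pmf ?p \<omega> = 0" if "rv_ind \<omega>"
      using that sub by (auto simp: set_pmf_iff)
    ultimately show "pmf (cond_pmf ?p {\<omega>. \<not> rv_ind \<omega>}) \<omega> = pmf ?p \<omega>"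
      by (subst pmf_cond) auto
  qed
  have inner: "?X \<bind> (\<lambda>X. mpc_query F E K M W S C \<bind> (\<lambda>Q. return_pmf (mpc_answer E M Q (W \<in> S) X)))
      = pmf_of_set ?A"
    if A: "S \<in> side_sets K M" "W \<in> {1..K} - S" "C \<in> coeff_seqs F E M" for S W C
  proof -
    \<comment> \<open>The query does not refer to the messages, so these may be drawn last.\<close>
    have "?X \<bind> (\<lambda>X. mpc_query F E K M W S C \<bind> (\<lambda>Q. return_pmf (mpc_answer E M Q (W \<in> S) X)))
      = mpc_query F E K M W S C \<bind> (\<lambda>Q. map_pmf (mpc_answer E M Q (W \<in> S)) ?X)"
      unfolding map_pmf_def by (rule bind_commute_pmf)
    also have "\<dots> = mpc_query F E K M W S C \<bind> (\<lambda>Q. pmf_of_set ?A)"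
    proof (rule bind_pmf_cong[OF refl])
      fix Q assume "Q \<in> set_pmf (mpc_query F E K M W S C)"
      then obtain \<pi> V where "\<pi> \<in> bijections {1..K} {1..K}" "length V = Suc M" "set V \<subseteq> nonzero"
        and Q: "Q = mpc_queries \<pi> V"
        by (rule mpc_query_support_lists[OF A])
      then show "map_pmf (mpc_answer E M Q (W \<in> S)) ?X = pmf_of_set ?A"
        unfolding Q by (intro answer_uniform)
    qed
    finally show ?thesis
      by simp
  qed
  have "map_pmf (rv_A (mpc F E K M)) ?p = pmf_of_set (side_sets K M) \<bind> (\<lambda>S.
      pmf_of_set ({1..K} - S) \<bind> (\<lambda>W. pmf_of_set (coeff_seqs F E M) \<bind> (\<lambda>C.
      ?X \<bind> (\<lambda>X. mpc_query F E K M W S C \<bind> (\<lambda>Q. return_pmf (mpc_answer E M Q (W \<in> S) X))))))"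
    by (simp add: model_I_def map_bind_pmf rv_A_def rv_ind_def mpc_def)
  also have "\<dots> = pmf_of_set (side_sets K M) \<bind> (\<lambda>S.
      pmf_of_set ({1..K} - S) \<bind> (\<lambda>W. pmf_of_set (coeff_seqs F E M) \<bind> (\<lambda>C. pmf_of_set ?A)))"
    using finite_side_sets side_sets_ne complement_ne finite_lists lists_ne
    by (intro bind_pmf_cong refl inner) (auto simp: coeff_seqs_eq)
  finally have "map_pmf (rv_A (mpc F E K M)) ?p = pmf_of_set ?A"
    by simp
  moreover have "finite ?A" "card ?A = card (carrier E) ^ num_blocks K M"
    using finite_lists_length_eq[OF finite_carrier] card_lists_length_eq[OF finite_carrier] by blast+
  moreover have "?A \<noteq> {}"
    using one_closed by (auto intro!: exI[of _ "replicate (num_blocks K M) \<one>"])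
  ultimately have "entropy_bits ?p (rv_A (mpc F E K M)) = log 2 (real ((q ^ l) ^ num_blocks K M))"
    using entropy_bits_uniform[OF finite_model] card by metis
  also have "\<dots> = real (num_blocks K M) * (real l * log 2 (real q))"
    using q by (simp add: log_nat_power)
  finally have "entropy_bits ?p (rv_A (mpc F E K M))
    = real (num_blocks K M) * (real l * log 2 (real q))" .
  \<comment> \<open>Together with \<open>1 \<le> l\<close> this allows the entropy of one message to
    be cancelled in the quotient.\<close>
  moreover have "0 < log 2 (real q)"
    using q by simp
  ultimately show ?thesis
    using l num_blocks_bounds(1)[OF KM] by (simp add: rate_I_def cond field_simps)
qed

text \<open>After the reordering, \<open>\<pi> j\<close> and the query still share \<pi>. For each
  fixed \<pi>, however, \<open>\<pi> j\<close> is uniform on the same set \<open>{1..K}\<close>, so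
  it can be replaced by an index \<open>w\<close> drawn afresh; the joint law of W and Q is then
  visibly a product.\<close>

lemma W_private: "W_private_I F E K M (mpc F E K M)"
proof -
  let ?p = "model_I F E K M (mpc F E K M)"
  let ?K = "pmf_of_set {1..K}" and ?S = "pmf_of_set (side_sets K M)" and ?F = "pmf_of_set nonzero"
  let ?C = "pmf_of_set (coeff_seqs F E M)" and ?P = "pmf_of_set (bijections {1..K} {1..K})"
  let ?V = "pmf_of_set {V. length V = Suc M \<and> set V \<subseteq> nonzero}"
  let ?\<sigma> = "\<lambda>j S. pmf_of_set (bijections (set (block_of j) - {j}) S)"
  let ?\<tau> = "\<lambda>j W S. pmf_of_set (bijections ({1..K} - set (block_of j)) ({1..K} - ({W} \<union> S)))"
  let ?\<pi> = "\<lambda>j W \<sigma> \<tau> i. if i = j then W else if i \<in> set (block_of j) then \<sigma> i else \<tau> i"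
  let ?v = "\<lambda>j S C c \<pi>. map (\<lambda>i. if i = j then c else coeff_at S C (\<pi> i)) (block_of j)"
  \<comment> \<open>\<open>C\<close> is drawn before \<sigma> and \<tau> but first used in V; moving
    it inwards brings it next to \<open>c\<close>, as \<open>random_coefficients\<close> requires. W
    is rewritten as \<open>\<pi> j\<close> so that what follows the permutation no longer mentions W
    or S.\<close>
  have coeffs: "?C \<bind> (\<lambda>C. ?\<sigma> j S \<bind> (\<lambda>\<sigma>. ?\<tau> j W S \<bind> (\<lambda>\<tau>. ?F \<bind> (\<lambda>c.
        return_pmf (W, mpc_queries (?\<pi> j W \<sigma> \<tau>) (?v j S C c (?\<pi> j W \<sigma> \<tau>)))))))
      = ?\<sigma> j S \<bind> (\<lambda>\<sigma>. ?\<tau> j W S \<bind> (\<lambda>\<tau>. return_pmf (?\<pi> j W \<sigma> \<tau>) \<bind> (\<lambda>\<pi>. ?V \<bind> (\<lambda>V.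
        return_pmf (\<pi> j, mpc_queries \<pi> V)))))" (is "?lhs = ?rhs")
    if S: "S \<in> side_sets K M" and W: "W \<in> {1..K} - S" and j: "j \<in> {1..K}" for S W j
  proof -
    have "?lhs = ?\<sigma> j S \<bind> (\<lambda>\<sigma>. ?C \<bind> (\<lambda>C. ?\<tau> j W S \<bind> (\<lambda>\<tau>. ?F \<bind> (\<lambda>c.
        return_pmf (W, mpc_queries (?\<pi> j W \<sigma> \<tau>) (?v j S C c (?\<pi> j W \<sigma> \<tau>)))))))"
      by (rule bind_commute_pmf)
    also have "\<dots> = ?\<sigma> j S \<bind> (\<lambda>\<sigma>. ?\<tau> j W S \<bind> (\<lambda>\<tau>. ?C \<bind> (\<lambda>C. ?F \<bind> (\<lambda>c.
        return_pmf (W, mpc_queries (?\<pi> j W \<sigma> \<tau>) (?v j S C c (?\<pi> j W \<sigma> \<tau>)))))))"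
      by (intro bind_pmf_cong refl bind_commute_pmf)
    also have "\<dots> = ?rhs"
    proof (intro bind_pmf_cong refl)
      fix \<sigma> \<tau> assume "\<sigma> \<in> set_pmf (?\<sigma> j S)" "\<tau> \<in> set_pmf (?\<tau> j W S)"
      then have \<sigma>: "\<sigma> \<in> bijections (set (block_of j) - {j}) S"
        and \<tau>: "\<tau> \<in> bijections ({1..K} - set (block_of j)) ({1..K} - ({W} \<union> S))"
        using stage_sets[OF S W j] by simp_all
      note \<pi> = glue_bijections[OF block_of(2,1)[OF j] side_setD(1)[OF S] W \<sigma> \<tau>]
      have "bij_betw (?\<pi> j W \<sigma> \<tau>) (set (block_of j) - {j}) S"
        using \<pi>(1,3) block_of(2)[OF j] by (auto simp: bijections_def bij_betw_def intro: inj_on_subset)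
      note V = random_coefficients[OF finite_nonzero nonzero_ne block_of(3,4,1)[OF j] this]
      have "?C \<bind> (\<lambda>C. ?F \<bind> (\<lambda>c.
          return_pmf (W, mpc_queries (?\<pi> j W \<sigma> \<tau>) (?v j S C c (?\<pi> j W \<sigma> \<tau>)))))
        = (?C \<bind> (\<lambda>C. ?F \<bind> (\<lambda>c. return_pmf (?v j S C c (?\<pi> j W \<sigma> \<tau>)))))
            \<bind> (\<lambda>V. return_pmf (W, mpc_queries (?\<pi> j W \<sigma> \<tau>) V))"
        by (simp only: bind_assoc_pmf bind_return_pmf)
      also have "\<dots> = ?V \<bind> (\<lambda>V. return_pmf (W, mpc_queries (?\<pi> j W \<sigma> \<tau>) V))"
        unfolding coeff_seqs_eq V ..
      finally show "?C \<bind> (\<lambda>C. ?F \<bind> (\<lambda>c.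
          return_pmf (W, mpc_queries (?\<pi> j W \<sigma> \<tau>) (?v j S C c (?\<pi> j W \<sigma> \<tau>)))))
        = return_pmf (?\<pi> j W \<sigma> \<tau>) \<bind> (\<lambda>\<pi>. ?V \<bind> (\<lambda>V. return_pmf (\<pi> j, mpc_queries \<pi> V)))"
        by (simp only: bind_return_pmf if_True simp_thms)
    qed
    finally show ?thesis .
  qed
  \<comment> \<open>The continuation \<open>f\<close> stands for everything drawn after the
    permutation.\<close>
  have perms: "?S \<bind> (\<lambda>S. pmf_of_set ({1..K} - S) \<bind> (\<lambda>W. ?\<sigma> j S \<bind> (\<lambda>\<sigma>. ?\<tau> j W S \<bind> (\<lambda>\<tau>.
      return_pmf (?\<pi> j W \<sigma> \<tau>) \<bind> f)))) = ?P \<bind> f"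
    if j: "j \<in> {1..K}" for j and f :: "(nat \<Rightarrow> nat) \<Rightarrow> (nat \<times> (nat list \<times> 'a list) list) pmf"
    unfolding random_permutation[OF finite_atLeastAtMost block_of(2,1,5)[OF j], symmetric] side_sets_def
    by (simp only: bind_assoc_pmf)
  have "map_pmf (\<lambda>\<omega>. (rv_W \<omega>, rv_Q \<omega>)) ?p = ?S \<bind> (\<lambda>S. pmf_of_set ({1..K} - S) \<bind> (\<lambda>W.
      ?C \<bind> (\<lambda>C. ?K \<bind> (\<lambda>j. ?\<sigma> j S \<bind> (\<lambda>\<sigma>. ?\<tau> j W S \<bind> (\<lambda>\<tau>. ?F \<bind> (\<lambda>c.
        return_pmf (W, mpc_queries (?\<pi> j W \<sigma> \<tau>) (?v j S C c (?\<pi> j W \<sigma> \<tau>))))))))))"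
    by (simp add: model_I_def map_bind_pmf mpc_def mpc_query_eq Let_def bind_assoc_pmf bind_return_pmf)
  also have "\<dots> = ?S \<bind> (\<lambda>S. pmf_of_set ({1..K} - S) \<bind> (\<lambda>W.
      ?K \<bind> (\<lambda>j. ?C \<bind> (\<lambda>C. ?\<sigma> j S \<bind> (\<lambda>\<sigma>. ?\<tau> j W S \<bind> (\<lambda>\<tau>. ?F \<bind> (\<lambda>c.
        return_pmf (W, mpc_queries (?\<pi> j W \<sigma> \<tau>) (?v j S C c (?\<pi> j W \<sigma> \<tau>))))))))))"
    by (intro bind_pmf_cong refl bind_commute_pmf)
  also have "\<dots> = ?S \<bind> (\<lambda>S. pmf_of_set ({1..K} - S) \<bind> (\<lambda>W. ?K \<bind> (\<lambda>j.
      ?\<sigma> j S \<bind> (\<lambda>\<sigma>. ?\<tau> j W S \<bind> (\<lambda>\<tau>. return_pmf (?\<pi> j W \<sigma> \<tau>) \<bind> (\<lambda>\<pi>. ?V \<bind> (\<lambda>V.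
        return_pmf (\<pi> j, mpc_queries \<pi> V))))))))"
  proof (intro bind_pmf_cong refl)
    fix S W j assume "S \<in> set_pmf ?S" "W \<in> set_pmf (pmf_of_set ({1..K} - S))" "j \<in> set_pmf ?K"
    then have "S \<in> side_sets K M" "W \<in> {1..K} - S" "j \<in> {1..K}"
      using finite_side_sets side_sets_ne complement_ne K_pos by simp_all
    then show "?C \<bind> (\<lambda>C. ?\<sigma> j S \<bind> (\<lambda>\<sigma>. ?\<tau> j W S \<bind> (\<lambda>\<tau>. ?F \<bind> (\<lambda>c.
        return_pmf (W, mpc_queries (?\<pi> j W \<sigma> \<tau>) (?v j S C c (?\<pi> j W \<sigma> \<tau>)))))))
      = ?\<sigma> j S \<bind> (\<lambda>\<sigma>. ?\<tau> j W S \<bind> (\<lambda>\<tau>. return_pmf (?\<pi> j W \<sigma> \<tau>) \<bind> (\<lambda>\<pi>. ?V \<bind> (\<lambda>V.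
        return_pmf (\<pi> j, mpc_queries \<pi> V)))))"
      by (rule coeffs)
  qed
  \<comment> \<open>Two exchanges bring \<open>j\<close> to the front, since
    \<open>random_permutation\<close> takes it as fixed.\<close>
  also have "\<dots> = ?S \<bind> (\<lambda>S. ?K \<bind> (\<lambda>j. pmf_of_set ({1..K} - S) \<bind> (\<lambda>W.
      ?\<sigma> j S \<bind> (\<lambda>\<sigma>. ?\<tau> j W S \<bind> (\<lambda>\<tau>. return_pmf (?\<pi> j W \<sigma> \<tau>) \<bind> (\<lambda>\<pi>. ?V \<bind> (\<lambda>V.
        return_pmf (\<pi> j, mpc_queries \<pi> V))))))))"
    by (intro bind_pmf_cong refl bind_commute_pmf)
  also have "\<dots> = ?K \<bind> (\<lambda>j. ?S \<bind> (\<lambda>S. pmf_of_set ({1..K} - S) \<bind> (\<lambda>W.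
      ?\<sigma> j S \<bind> (\<lambda>\<sigma>. ?\<tau> j W S \<bind> (\<lambda>\<tau>. return_pmf (?\<pi> j W \<sigma> \<tau>) \<bind> (\<lambda>\<pi>. ?V \<bind> (\<lambda>V.
        return_pmf (\<pi> j, mpc_queries \<pi> V))))))))"
    by (rule bind_commute_pmf)
  also have "\<dots> = ?K \<bind> (\<lambda>j. ?P \<bind> (\<lambda>\<pi>. ?V \<bind> (\<lambda>V. return_pmf (\<pi> j, mpc_queries \<pi> V))))"
  proof (rule bind_pmf_cong[OF refl])
    fix j assume "j \<in> set_pmf ?K"
    then have j: "j \<in> {1..K}"
      using K_pos by simp
    show "?S \<bind> (\<lambda>S. pmf_of_set ({1..K} - S) \<bind> (\<lambda>W.
      ?\<sigma> j S \<bind> (\<lambda>\<sigma>. ?\<tau> j W S \<bind> (\<lambda>\<tau>. return_pmf (?\<pi> j W \<sigma> \<tau>) \<bind> (\<lambda>\<pi>. ?V \<bind> (\<lambda>V.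
        return_pmf (\<pi> j, mpc_queries \<pi> V)))))))
      = ?P \<bind> (\<lambda>\<pi>. ?V \<bind> (\<lambda>V. return_pmf (\<pi> j, mpc_queries \<pi> V)))"
      by (rule perms[OF j])
  qed
  also have "\<dots> = ?P \<bind> (\<lambda>\<pi>. ?K \<bind> (\<lambda>j. ?V \<bind> (\<lambda>V. return_pmf (\<pi> j, mpc_queries \<pi> V))))"
    by (rule bind_commute_pmf)
  also have "\<dots> = ?P \<bind> (\<lambda>\<pi>. ?K \<bind> (\<lambda>w. ?V \<bind> (\<lambda>V. return_pmf (w, mpc_queries \<pi> V))))"
  proof (rule bind_pmf_cong[OF refl])
    fix \<pi> assume "\<pi> \<in> set_pmf ?P"
    moreover have "bijections {1..K} {1..K} \<noteq> {}"
      using card_bijections[of "{1..K}" "{1..K}"] by (metis card.empty fact_nonzero finite_atLeastAtMost)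
    ultimately have "bij_betw \<pi> {1..K} {1..K}"
      using finite_bijections[of "{1..K}" "{1..K}"] by (simp add: bijections_def)
    then have K: "?K = map_pmf \<pi> ?K"
      using K_pos by (simp add: map_pmf_of_set_bij_betw)
    show "?K \<bind> (\<lambda>j. ?V \<bind> (\<lambda>V. return_pmf (\<pi> j, mpc_queries \<pi> V)))
        = ?K \<bind> (\<lambda>w. ?V \<bind> (\<lambda>V. return_pmf (w, mpc_queries \<pi> V)))"
      \<comment> \<open>Only the second occurrence, the draw of \<open>w\<close>, is pushed along
        \<pi>.\<close>
      by (subst (2) K) (simp only: bind_map_pmf)
  qed
  also have "\<dots> = ?K \<bind> (\<lambda>w. ?P \<bind> (\<lambda>\<pi>. ?V \<bind> (\<lambda>V. return_pmf (w, mpc_queries \<pi> V))))"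
    by (rule bind_commute_pmf)
  also have "\<dots> = pair_pmf ?K (?P \<bind> (\<lambda>\<pi>. ?V \<bind> (\<lambda>V. return_pmf (mpc_queries \<pi> V))))"
    by (simp only: pair_pmf_def bind_assoc_pmf bind_return_pmf)
  finally have WQ: "map_pmf (\<lambda>\<omega>. (rv_W \<omega>, rv_Q \<omega>)) ?p
    = pair_pmf ?K (?P \<bind> (\<lambda>\<pi>. ?V \<bind> (\<lambda>V. return_pmf (mpc_queries \<pi> V))))" .
  show ?thesis
    unfolding W_private_I_def
    by (rule cond_mutual_info_bits_eq_0[where z = False, OF finite_model _ WQ])
      (simp add: model_support(6))
qed

end

theorem lemma9:
  fixes E :: "('a, 'b) ring_scheme" and F :: "'a set" and K M q l :: nat
  assumes "1 \<le> M" and "M \<le> K - 1"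
    and "primepow q" and "1 \<le> l"
    and "field E" and "finite (carrier E)" and "card (carrier E) = q ^ l"
    and "subfield F E" and "card F = q"
  shows "PIR_CSI_I F E K M (mpc F E K M)
    \<and> scalar_linear_I F E K M (mpc F E K M)
    \<and> rate_I q l F E K M (mpc F E K M) = inverse (real_of_int \<lceil>real K / real (M + 1)\<rceil>)"
proof -
  \<comment> \<open>In truncated subtraction \<open>M \<le> K - 1\<close> yields
    \<open>M + 1 \<le> K\<close> because \<open>1 \<le> M\<close> excludes
    \<open>K = 0\<close>.\<close>
  interpret mpc_scheme E F K M
    using assms by (intro mpc_scheme.intro mpc_scheme_axioms.intro) auto
  have "2 \<le> q"
    using primepow_gt_Suc_0[OF assms(3)] by simp
  \<comment> \<open>The ceiling is nonnegative, so passing through \<open>nat\<close> loses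
    nothing.\<close>
  moreover have "real (num_blocks K M) = real_of_int \<lceil>real K / real (M + 1)\<rceil>"
    unfolding num_blocks_def by (simp add: of_nat_nat)
  ultimately show ?thesis
    using recoverable W_private scalar_linear rate assms(4,7) by (simp add: PIR_CSI_I_def)
qed

end
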